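(* Let $0<\delta<\frac{1}{\sqrt2}$. Let $f_1$ be a solution of the Helmholtz equation (with wave number $k$) in a neighborhood of $D_c$, let $s\in L^2(\partial D_c)$ be a random perturbation with $\|s\|_{L^2(\partial D_c)}\le 2\|f_1\|_{L^2(\partial D_c)}$, and put $f_\epsilon=(f_1+\epsilon s,0)\in\Xi$. For every $\epsilon\ge 0$ consider $\phi_{\alpha_\epsilon}=(\alpha_\epsilon I+K^*K)^{-1}K^*f_\epsilon\in C(\partial D_a)$, with $\alpha_\epsilon=\alpha(\epsilon)$ the Morozov solution of $g(\alpha,\epsilon)=\delta^2$. Then $$\frac{\|\phi_{\alpha_\epsilon}-\phi_{\alpha_0}\|_{L^2(\partial D_a)}}{\|\phi_{\alpha_\epsilon}\|_{L^2(\partial D_a)}}\le\frac{\left|\dfrac{\alpha_\epsilon}{\alpha_0}-1\right|+\sqrt{\left|\dfrac{\alpha_\epsilon}{\alpha_0}-1\right|^2+16\,\dfrac{\epsilon\,(2\delta+C\delta\epsilon+C\epsilon)}{\alpha_0}\,\|K_1^*\|_{\mathcal O}}}{2},$$ where $C$ denotes a generic constant depending only on the operator $K$, on $d_c=\operatorname{diam}(D_c)$ and on $d=\operatorname{dist}(\partial D_c,\partial D_a)$, and $\|\cdot\|_{\mathcal O}$ denotes the operator norm.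
   Context: Setting (in $\mathbb{R}^2$). $B_R=B_R(\mathbf 0)$ is the disk of radius $R>0$ centered at the origin. $D_a\subset B_R$ (antenna) is a region containing $\mathbf 0$ with sufficiently smooth boundary, and $D_c\Subset B_R$ (control region) satisfies $\overline{D_c}\cap\overline{D_a}=\emptyset$. The wave number $k>0$ is such that $-k^2$ is not a Neumann eigenvalue of the Laplace operator in $D_a$ or in $B_R$, and is not a Dirichlet eigenvalue of the Laplace operator in $D_c$. All $L^2$ spaces consist of complex-valued functions with the usual inner product. $\Xi=L^2(\partial D_c)\times L^2(\partial B_R)$ is the Hilbert space with inner product $(\phi,\psi)_\Xi=\int_{\partial D_c}\phi_1\overline{\psi_1}\,dS+\int_{\partial B_R}\phi_2\overline{\psi_2}\,dS$. Let $\Phi(\mathbf x,\mathbf y)=\frac{i}{4}H_0^{(1)}(k|\mathbf x-\mathbf y|)$ be the fundamental solution of the Helmholtz operator ($H_0^{(1)}$ the Hankel function of the first kind), and let $\nu_{\mathbf y}$ be the unit outward normal to $\partial D_a$. The operator $K:L^2(\partial D_a)\to\Xi$ is $K\phi=(K_1\phi,K_2\phi)$, where $$K_1\phi(\mathbf x)=\int_{\partial D_a}\phi(\mathbf y)\frac{\partial\Phi(\mathbf x,\mathbf y)}{\partial\nu_{\mathbf y}}\,dS_{\mathbf y}\ (\mathbf x\in\partial D_c),\qquad K_2\phi(\mathbf z)=\int_{\partial D_a}\phi(\mathbf y)\frac{\partial\Phi(\mathbf z,\mathbf y)}{\partial\nu_{\mathbf y}}\,dS_{\mathbf y}\ (\mathbf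 z\in\partial B_R).$$ $K^*:\Xi\to L^2(\partial D_a)$ and $K_1^*:L^2(\partial D_c)\to L^2(\partial D_a)$ are the adjoints of $K$ and $K_1$. For $\phi\in L^2(\partial D_a)$ and $h=(h_1,0)\in\Xi$ with $h_1\ne0$, the weighted residual is $$E(\phi,h)=\frac{1}{\|h_1\|^2_{L^2(\partial D_c)}}\|K_1\phi-h_1\|^2_{L^2(\partial D_c)}+\frac{1}{2\pi R}\|K_2\phi\|^2_{L^2(\partial B_R)} .$$ For $\alpha>0$ set $g(\alpha,\epsilon)=E\big((\alpha I+K^*K)^{-1}K^*f_\epsilon,\ f_\epsilon\big)$. The Morozov solution $\alpha(\epsilon)$ is the largest $\alpha\in(0,\infty)$ with $g(\alpha,\epsilon)=\delta^2$ (its existence is taken as known from classical results). $\phi_{\alpha_0}$ denotes $\phi_{\alpha_\epsilon}$ for $\epsilon=0$.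
   Formalization: Assumes ‖f_1‖ ≤ M‖f_1+εs‖ on ∂D_c for a fixed M, and C may also depend on M: for s=−2f_1, ε→1/2 the left side blows up while the right stays bounded. D_a ⊂ B_R is read as closure of D_a inside B_R, and ∂D_c has finite length. *)

theory Defs
  imports "HOL-Analysis.Analysis"
begin

type_synonym plane = "real^2"
type_synonym field = "plane \<Rightarrow> complex"

text \<open>Differential operators, classical regularity and eigenvalues.\<close>

definition pderiv_at :: "2 \<Rightarrow> field \<Rightarrow> field" where
  "pderiv_at i u x = vector_derivative (\<lambda>t::real. u (x + t *\<^sub>R axis i 1)) (at 0)"

definition laplacian :: "field \<Rightarrow> field" where
  "laplacian u x = (\<Sum>i\<in>UNIV. pderiv_at i (pderiv_at i u) x)"

definition C2_on :: "plane set \<Rightarrow> field \<Rightarrow> bool" where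
  "C2_on U u \<longleftrightarrow>
     (\<forall>x\<in>U. u differentiable (at x)) \<and>
     (\<forall>i. \<forall>x\<in>U. pderiv_at i u differentiable (at x)) \<and>
     (\<forall>i j. continuous_on U (pderiv_at i (pderiv_at j u)))"

definition helmholtz_solution_on :: "real \<Rightarrow> plane set \<Rightarrow> field \<Rightarrow> bool" where
  "helmholtz_solution_on k U u \<longleftrightarrow>
     C2_on U u \<and> (\<forall>x\<in>U. laplacian u x + (of_real k)\<^sup>2 * u x = 0)"

text \<open>The boundary is locally, in a rotated orthonormal frame \<open>(e, n)\<close>, the graph of a
  \<open>C\<^sup>2\<close> function with the set lying below it.\<close>

definition C2_boundary :: "plane set \<Rightarrow> bool" where
  "C2_boundary D \<longleftrightarrow> (\<forall>x\<in>frontier D. \<exists>r e n. \<exists>h h' h'' :: real \<Rightarrow> real.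
     0 < r \<and> norm e = 1 \<and> norm n = 1 \<and> e \<bullet> n = 0 \<and>
     (\<forall>t. (h has_real_derivative h' t) (at t)) \<and>
     (\<forall>t. (h' has_real_derivative h'' t) (at t)) \<and>
     continuous_on UNIV h'' \<and>
     D \<inter> ball x r = {y \<in> ball x r. y \<bullet> n < h (y \<bullet> e)})"

text \<open>The unit vector that separates the directions pointing into \<open>D\<close> from those pointing
  out of it; at a boundary point of a set with \<open>C\<^sup>1\<close> boundary there is exactly one.\<close>

definition outward_normal :: "plane set \<Rightarrow> plane \<Rightarrow> plane" where
  "outward_normal D x = (THE n. norm n = 1 \<and>
     (\<forall>v. v \<bullet> n < 0 \<longrightarrow> (\<forall>\<^sub>F t in at_right 0. x + t *\<^sub>R v \<in> D)) \<and>
     (\<forall>v. v \<bullet> n > 0 \<longrightarrow> (\<forall>\<^sub>F t in at_right 0. x + t *\<^sub>R v \<notin> D)))"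

definition dirichlet_eigenvalue :: "plane set \<Rightarrow> real \<Rightarrow> bool" where
  "dirichlet_eigenvalue D lam \<longleftrightarrow> (\<exists>u. C2_on D u \<and> continuous_on (closure D) u \<and>
     (\<exists>x\<in>D. u x \<noteq> 0) \<and>
     (\<forall>x\<in>D. laplacian u x = of_real lam * u x) \<and>
     (\<forall>x\<in>frontier D. u x = 0))"

text \<open>\<open>G\<close> is the continuous extension of the gradient of \<open>u\<close> to the closure of \<open>D\<close>.\<close>

definition neumann_eigenvalue :: "plane set \<Rightarrow> real \<Rightarrow> bool" where
  "neumann_eigenvalue D lam \<longleftrightarrow> (\<exists>u G. C2_on D u \<and> continuous_on (closure D) u \<and>
     (\<forall>i. continuous_on (closure D) (G i) \<and> (\<forall>x\<in>D. G i x = pderiv_at i u x)) \<and>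
     (\<exists>x\<in>D. u x \<noteq> 0) \<and>
     (\<forall>x\<in>D. laplacian u x = of_real lam * u x) \<and>
     (\<forall>x\<in>frontier D. (\<Sum>i\<in>UNIV. of_real (outward_normal D x $ i) * G i x) = 0))"

text \<open>Arc length on boundaries is the one-dimensional Hausdorff measure. It is a metric outer
  measure, hence countably additive on Borel sets, so \<^const>\<open>measure_of\<close> below does not
  fall back to the zero measure.\<close>

definition hausdorff1 :: "plane set \<Rightarrow> ennreal" where
  "hausdorff1 A = (SUP d\<in>{0<..}.
     INF U\<in>{U :: nat \<Rightarrow> plane set. A \<subseteq> (\<Union>i. U i) \<and> (\<forall>i. bounded (U i) \<and> diameter (U i) \<le> d)}.
       \<Sum>i. ennreal (diameter (U i)))"

definition arc_measure :: "plane set \<Rightarrow> plane measure" where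
  "arc_measure D = restrict_space (measure_of UNIV (sets borel) hausdorff1) (frontier D)"

text \<open>Complex \<open>L\<^sup>2\<close> spaces. Elements are represented by functions; equality in \<open>L\<^sup>2\<close> is
  equality almost everywhere.\<close>

definition l2 :: "plane measure \<Rightarrow> field set" where
  "l2 M = {f \<in> borel_measurable M. integrable M (\<lambda>x. (cmod (f x))\<^sup>2)}"

definition l2_inner :: "plane measure \<Rightarrow> field \<Rightarrow> field \<Rightarrow> complex" where
  "l2_inner M f g = (LINT x|M. f x * cnj (g x))"

definition l2_norm :: "plane measure \<Rightarrow> field \<Rightarrow> real" where
  "l2_norm M f = sqrt (LINT x|M. (cmod (f x))\<^sup>2)"

definition Xi :: "plane measure \<Rightarrow> plane measure \<Rightarrow> (field \<times> field) set" where
  "Xi M N = l2 M \<times> l2 N"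

definition Xi_inner :: "plane measure \<Rightarrow> plane measure \<Rightarrow> field \<times> field \<Rightarrow> field \<times> field \<Rightarrow> complex" where
  "Xi_inner M N p q = l2_inner M (fst p) (fst q) + l2_inner N (snd p) (snd q)"

definition adjoint_on ::
  "'a set \<Rightarrow> ('a \<Rightarrow> 'a \<Rightarrow> complex) \<Rightarrow> ('b \<Rightarrow> 'b \<Rightarrow> complex) \<Rightarrow> ('a \<Rightarrow> 'b) \<Rightarrow> 'b \<Rightarrow> 'a" where
  "adjoint_on H ipH ipG T \<psi> = (SOME \<eta>. \<eta> \<in> H \<and> (\<forall>\<phi>\<in>H. ipG (T \<phi>) \<psi> = ipH \<phi> \<eta>))"

definition l2_opnorm :: "plane measure \<Rightarrow> plane measure \<Rightarrow> (field \<Rightarrow> field) \<Rightarrow> real" where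
  "l2_opnorm M N T = (SUP f\<in>{f \<in> l2 M. l2_norm M f \<le> 1}. l2_norm N (T f))"

text \<open>Bessel functions of order zero by their standard power series (positive real argument).\<close>

definition bessel_J0 :: "real \<Rightarrow> real" where
  "bessel_J0 x = (\<Sum>m. (-1) ^ m * (x / 2) ^ (2 * m) / (fact m)\<^sup>2)"

definition bessel_Y0 :: "real \<Rightarrow> real" where
  "bessel_Y0 x = 2 / pi * (ln (x / 2) + euler_mascheroni) * bessel_J0 x
     - 2 / pi * (\<Sum>m. (-1) ^ m * harm m * (x / 2) ^ (2 * m) / (fact m)\<^sup>2)"

definition hankel1_0 :: "real \<Rightarrow> complex" where
  "hankel1_0 x = Complex (bessel_J0 x) (bessel_Y0 x)"

definition helmholtz_Phi :: "real \<Rightarrow> plane \<Rightarrow> plane \<Rightarrow> complex" where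
  "helmholtz_Phi k x y = \<i> / 4 * hankel1_0 (k * norm (x - y))"

definition normal_deriv_Phi :: "real \<Rightarrow> plane set \<Rightarrow> plane \<Rightarrow> plane \<Rightarrow> complex" where
  "normal_deriv_Phi k D x y =
     vector_derivative (\<lambda>t::real. helmholtz_Phi k x (y + t *\<^sub>R outward_normal D y)) (at 0)"

definition double_layer :: "real \<Rightarrow> plane set \<Rightarrow> field \<Rightarrow> field" where
  "double_layer k D \<phi> x = (LINT y|arc_measure D. \<phi> y * normal_deriv_Phi k D x y)"

definition K1 :: "real \<Rightarrow> plane set \<Rightarrow> plane set \<Rightarrow> field \<Rightarrow> field" where
  "K1 k Da Dc \<phi> = restrict (double_layer k Da \<phi>) (frontier Dc)"

definition K2 :: "real \<Rightarrow> real \<Rightarrow> plane set \<Rightarrow> field \<Rightarrow> field" where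
  "K2 k R Da \<phi> = restrict (double_layer k Da \<phi>) (frontier (ball 0 R))"

definition K :: "real \<Rightarrow> real \<Rightarrow> plane set \<Rightarrow> plane set \<Rightarrow> field \<Rightarrow> field \<times> field" where
  "K k R Da Dc \<phi> = (K1 k Da Dc \<phi>, K2 k R Da \<phi>)"

definition K_adj :: "real \<Rightarrow> real \<Rightarrow> plane set \<Rightarrow> plane set \<Rightarrow> field \<times> field \<Rightarrow> field" where
  "K_adj k R Da Dc = adjoint_on (l2 (arc_measure Da)) (l2_inner (arc_measure Da))
     (Xi_inner (arc_measure Dc) (arc_measure (ball 0 R))) (K k R Da Dc)"

definition K1_adj :: "real \<Rightarrow> plane set \<Rightarrow> plane set \<Rightarrow> field \<Rightarrow> field" where
  "K1_adj k Da Dc = adjoint_on (l2 (arc_measure Da)) (l2_inner (arc_measure Da))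
     (l2_inner (arc_measure Dc)) (K1 k Da Dc)"

text \<open>An operator comes with its domain and target: here \<open>L\<^sup>2(\<partial>D\<^sub>a)\<close>, the two factors of
  the target, and the map.\<close>

type_synonym operator =
  "plane measure \<times> plane measure \<times> plane measure \<times> (field \<Rightarrow> field \<times> field)"

definition K_operator :: "real \<Rightarrow> real \<Rightarrow> plane set \<Rightarrow> plane set \<Rightarrow> operator" where
  "K_operator k R Da Dc =
     (arc_measure Da, arc_measure Dc, arc_measure (ball 0 R),
      restrict (K k R Da Dc) (l2 (arc_measure Da)))"

text \<open>\<open>(\<alpha>I + K\<^sup>*K)\<^sup>-\<^sup>1 K\<^sup>* f\<close>, i.e. the solution of \<open>\<alpha>\<phi> + K\<^sup>*K\<phi> = K\<^sup>*f\<close> in \<open>L\<^sup>2(\<partial>D\<^sub>a)\<close>,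
  represented by its continuous representative.\<close>

definition tikhonov ::
  "real \<Rightarrow> real \<Rightarrow> plane set \<Rightarrow> plane set \<Rightarrow> real \<Rightarrow> field \<times> field \<Rightarrow> field" where
  "tikhonov k R Da Dc \<alpha> f = (SOME \<phi>. \<phi> \<in> l2 (arc_measure Da) \<and> continuous_on (frontier Da) \<phi> \<and>
     (AE y in arc_measure Da.
        of_real \<alpha> * \<phi> y + K_adj k R Da Dc (K k R Da Dc \<phi>) y = K_adj k R Da Dc f y))"

definition residual ::
  "real \<Rightarrow> real \<Rightarrow> plane set \<Rightarrow> plane set \<Rightarrow> field \<Rightarrow> field \<times> field \<Rightarrow> real" where
  "residual k R Da Dc \<phi> h =
     1 / (l2_norm (arc_measure Dc) (fst h))\<^sup>2 *
       (l2_norm (arc_measure Dc) (\<lambda>x. K1 k Da Dc \<phi> x - fst h x))\<^sup>2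
     + 1 / (2 * pi * R) * (l2_norm (arc_measure (ball 0 R)) (K2 k R Da \<phi>))\<^sup>2"

definition noisy :: "field \<Rightarrow> field \<Rightarrow> real \<Rightarrow> field \<times> field" where
  "noisy f1 s \<epsilon> = ((\<lambda>x. f1 x + of_real \<epsilon> * s x), (\<lambda>x. 0))"

text \<open>The largest \<open>\<alpha>\<close> in \<open>(0, \<infinity>)\<close> with \<open>E((\<alpha>I + K\<^sup>*K)\<^sup>-\<^sup>1 K\<^sup>* f, f) = \<delta>\<^sup>2\<close>.\<close>

definition morozov ::
  "real \<Rightarrow> real \<Rightarrow> plane set \<Rightarrow> plane set \<Rightarrow> real \<Rightarrow> field \<times> field \<Rightarrow> real \<Rightarrow> bool" where
  "morozov k R Da Dc \<delta> f \<alpha> \<longleftrightarrow>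
     (let g = (\<lambda>\<beta>. residual k R Da Dc (tikhonov k R Da Dc \<beta> f) f)
      in l2_norm (arc_measure Dc) (fst f) \<noteq> 0 \<and>
         0 < \<alpha> \<and> g \<alpha> = \<delta>\<^sup>2 \<and> (\<forall>\<beta>>0. g \<beta> = \<delta>\<^sup>2 \<longrightarrow> \<beta> \<le> \<alpha>))"

text \<open>Finite boundary length of \<open>D\<^sub>c\<close> is what makes \<open>K\<^sub>1\<close> map into \<open>L\<^sup>2(\<partial>D\<^sub>c)\<close>; no
  further regularity of \<open>D\<^sub>c\<close> is required.\<close>

definition antenna_setting :: "real \<Rightarrow> real \<Rightarrow> plane set \<Rightarrow> plane set \<Rightarrow> bool" where
  "antenna_setting k R Da Dc \<longleftrightarrow>
     0 < R \<and> 0 < k \<and>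
     open Da \<and> connected Da \<and> 0 \<in> Da \<and> closure Da \<subseteq> ball 0 R \<and> C2_boundary Da \<and>
     open Dc \<and> connected Dc \<and> Dc \<noteq> {} \<and> closure Dc \<subseteq> ball 0 R \<and>
     hausdorff1 (frontier Dc) < \<infinity> \<and>
     closure Dc \<inter> closure Da = {} \<and>
     \<not> neumann_eigenvalue Da (- k\<^sup>2) \<and> \<not> neumann_eigenvalue (ball 0 R) (- k\<^sup>2) \<and>
     \<not> dirichlet_eigenvalue Dc (- k\<^sup>2)"

end

theory Submission
  imports Defs
begin

text \<open>Put \<open>w = \<phi>\<^sub>\<epsilon> - \<phi>\<^sub>0\<close>. Subtracting the two normal equations and testing with \<open>w\<close> gives
  \<open>\<alpha>\<^sub>0 \<parallel>w\<parallel>\<^sup>2 + \<parallel>K w\<parallel>\<^sup>2 = \<epsilon> Re \<langle>s, K\<^sub>1 w\<rangle> + (\<alpha>\<^sub>0 - \<alpha>\<^sub>\<epsilon>) Re \<langle>\<phi>\<^sub>\<epsilon>, w\<rangle>\<close>. The first term on the right is at most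
  \<open>\<epsilon>\<^sup>2 \<parallel>s\<parallel>\<^sup>2 / 4 + \<parallel>K\<^sub>1 w\<parallel>\<^sup>2\<close>, so \<open>K w\<close> drops out. Since the relative residual is at most \<open>\<delta> < 1\<close>,
  \<open>\<parallel>f\<^sub>\<epsilon>\<parallel>\<close>, and with it \<open>\<parallel>s\<parallel>\<close>, is bounded by a multiple of \<open>\<parallel>K\<^sub>1\<^sup>*\<parallel> \<parallel>\<phi>\<^sub>\<epsilon>\<parallel>\<close>. What remains is a quadratic
  inequality for \<open>\<parallel>w\<parallel> / \<parallel>\<phi>\<^sub>\<epsilon>\<parallel>\<close>. The analytic input is that the kernel of \<open>K\<close> is continuous on
  compact boundaries of finite length.\<close>

text \<open>\<open>adjoint_on\<close> and \<open>tikhonov\<close> are choices, so nothing follows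
  from them before a witness exists; most of the development builds these witnesses. For the adjoint
  it is the integral operator with the conjugated, transposed kernel. For \<open>tikhonov\<close> it
  has to be a continuous function solving a second kind equation, so convergence in the supremum
  norm must be reached for an operator whose positivity is known only in the L2 sense. Elements of
  L2 are represented by functions, and the chosen adjoints are known only almost everywhere; the
  estimates therefore use the weak form of the normal equation. The energy estimate leaves a term
  with the factor \<open>\<epsilon>\<^sup>2\<close> times the square of the norm of
  \<open>s\<close>. It is fitted under the summand \<open>c * \<epsilon>\<close> of the bracket; the
  surplus factor, one operator norm of the adjoint of K1, is absorbed into \<open>C\<close>. Since
  \<open>s\<close> is measured against \<open>f1\<close>, but \<open>\<phi>\<^sub>\<epsilon>\<close>
  against the noisy data, the noisy data have to control \<open>f1\<close>.\<close>

subsection \<open>Complex square-integrable functions\<close>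

lemma l2_measurable: "f \<in> l2 M \<Longrightarrow> f \<in> borel_measurable M"
  by (simp add: l2_def)

lemma l2_square_integrable: "f \<in> l2 M \<Longrightarrow> integrable M (\<lambda>x. (cmod (f x))\<^sup>2)"
  by (simp add: l2_def)

lemma l2_cong:
  assumes "f \<in> l2 M" "\<And>x. x \<in> space M \<Longrightarrow> g x = f x"
  shows "g \<in> l2 M"
proof -
  have "g \<in> borel_measurable M \<longleftrightarrow> f \<in> borel_measurable M"
    by (rule measurable_cong) (use assms(2) in auto)
  moreover have "integrable M (\<lambda>x. (cmod (g x))\<^sup>2) \<longleftrightarrow> integrable M (\<lambda>x. (cmod (f x))\<^sup>2)"
    by (rule Bochner_Integration.integrable_cong) (use assms(2) in auto)
  ultimately show ?thesis
    using assms(1) by (simp add: l2_def)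
qed

lemma l2_integrable_cmod_mult:
  assumes "f \<in> l2 M" "g \<in> l2 M"
  shows "integrable M (\<lambda>x. cmod (f x) * cmod (g x))"
proof (rule Bochner_Integration.integrable_bound)
  show "integrable M (\<lambda>x. (cmod (f x))\<^sup>2 + (cmod (g x))\<^sup>2)"
    using assms by (intro Bochner_Integration.integrable_add l2_square_integrable)
  show "(\<lambda>x. cmod (f x) * cmod (g x)) \<in> borel_measurable M"
    using assms[THEN l2_measurable] by measurable
  have "cmod (f x) * cmod (g x) \<le> (cmod (f x))\<^sup>2 + (cmod (g x))\<^sup>2" for x
  proof -
    have "0 \<le> (cmod (f x) - cmod (g x))\<^sup>2" "0 \<le> (cmod (f x))\<^sup>2" "0 \<le> (cmod (g x))\<^sup>2" by simp_all
    then show ?thesis unfolding power2_diff by linarith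
  qed
  then show "AE x in M. norm (cmod (f x) * cmod (g x)) \<le> norm ((cmod (f x))\<^sup>2 + (cmod (g x))\<^sup>2)"
    by simp
qed

lemma l2_integrable_mult_cnj:
  assumes "f \<in> l2 M" "g \<in> l2 M"
  shows "integrable M (\<lambda>x. f x * cnj (g x))"
proof (rule Bochner_Integration.integrable_bound[OF l2_integrable_cmod_mult[OF assms]])
  have "cnj \<in> borel_measurable borel"
    by (intro borel_measurable_continuous_onI continuous_intros)
  from measurable_compose[OF l2_measurable[OF assms(2)] this]
  show "(\<lambda>x. f x * cnj (g x)) \<in> borel_measurable M"
    using l2_measurable[OF assms(1)] by measurable
qed (simp add: norm_mult)

lemma l2_linear_combination:
  assumes "f \<in> l2 M" "g \<in> l2 M"
  shows "(\<lambda>x. a * f x + b * g x) \<in> l2 M"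
proof -
  have "integrable M (\<lambda>x. (cmod (a * f x + b * g x))\<^sup>2)"
  proof (rule Bochner_Integration.integrable_bound)
    show "integrable M (\<lambda>x. 2 * (cmod a)\<^sup>2 * (cmod (f x))\<^sup>2 + 2 * (cmod b)\<^sup>2 * (cmod (g x))\<^sup>2)"
      using assms by (intro Bochner_Integration.integrable_add integrable_mult_right l2_square_integrable)
    show "(\<lambda>x. (cmod (a * f x + b * g x))\<^sup>2) \<in> borel_measurable M"
      using assms[THEN l2_measurable] by measurable
    have "(cmod (a * f x + b * g x))\<^sup>2 \<le> 2 * (cmod a)\<^sup>2 * (cmod (f x))\<^sup>2 + 2 * (cmod b)\<^sup>2 * (cmod (g x))\<^sup>2" for x
    proof -
      have "(cmod (a * f x + b * g x))\<^sup>2 \<le> (cmod (a * f x) + cmod (b * g x))\<^sup>2"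
        by (intro power_mono norm_triangle_ineq norm_ge_zero)
      also have "\<dots> \<le> 2 * (cmod (a * f x))\<^sup>2 + 2 * (cmod (b * g x))\<^sup>2"
        using zero_le_power2[of "cmod (a * f x) - cmod (b * g x)"]
        unfolding power2_diff power2_sum by linarith
      finally show ?thesis by (simp add: norm_mult power_mult_distrib)
    qed
    then show "AE x in M. norm ((cmod (a * f x + b * g x))\<^sup>2)
        \<le> norm (2 * (cmod a)\<^sup>2 * (cmod (f x))\<^sup>2 + 2 * (cmod b)\<^sup>2 * (cmod (g x))\<^sup>2)"
      by simp
  qed
  then show ?thesis
    using assms[THEN l2_measurable] by (simp add: l2_def)
qed

lemma l2_add: "f \<in> l2 M \<Longrightarrow> g \<in> l2 M \<Longrightarrow> (\<lambda>x. f x + g x) \<in> l2 M"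
  using l2_linear_combination[of f M g 1 1] by simp

lemma l2_diff: "f \<in> l2 M \<Longrightarrow> g \<in> l2 M \<Longrightarrow> (\<lambda>x. f x - g x) \<in> l2 M"
  using l2_linear_combination[of f M g 1 "-1"] by simp

lemma l2_scale: "f \<in> l2 M \<Longrightarrow> (\<lambda>x. c * f x) \<in> l2 M"
  using l2_linear_combination[of f M f c 0] by simp

lemma l2_norm_nonneg: "0 \<le> l2_norm M f"
  by (simp add: l2_norm_def)

lemma l2_norm_power2: "(l2_norm M f)\<^sup>2 = (LINT x|M. (cmod (f x))\<^sup>2)"
  by (simp add: l2_norm_def)

lemma l2_norm_cong: "(\<And>x. x \<in> space M \<Longrightarrow> f x = g x) \<Longrightarrow> l2_norm M f = l2_norm M g"
  unfolding l2_norm_def by (rule arg_cong[of _ _ sqrt], rule Bochner_Integration.integral_cong) auto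

lemma l2_inner_cong:
  "(\<And>x. x \<in> space M \<Longrightarrow> f x = f' x) \<Longrightarrow> (\<And>x. x \<in> space M \<Longrightarrow> g x = g' x) \<Longrightarrow>
    l2_inner M f g = l2_inner M f' g'"
  unfolding l2_inner_def by (rule Bochner_Integration.integral_cong) auto

lemma l2_inner_cong_AE:
  assumes "f \<in> l2 M" "f' \<in> l2 M" "g \<in> l2 M" "AE x in M. f x = f' x"
  shows "l2_inner M f g = l2_inner M f' g"
  unfolding l2_inner_def
proof (rule integral_cong_AE)
  show "AE x in M. f x * cnj (g x) = f' x * cnj (g x)"
    using assms(4) by eventually_elim simp
qed (use assms l2_integrable_mult_cnj borel_measurable_integrable in blast)+

lemma l2_inner_self: "l2_inner M f f = of_real ((l2_norm M f)\<^sup>2)"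
proof -
  have "l2_inner M f f = (LINT x|M. complex_of_real ((cmod (f x))\<^sup>2))"
    unfolding l2_inner_def by (rule Bochner_Integration.integral_cong) (simp_all only: complex_norm_square)
  also have "\<dots> = of_real ((l2_norm M f)\<^sup>2)"
    unfolding l2_norm_power2 by (rule integral_complex_of_real)
  finally show ?thesis .
qed

lemma l2_inner_commute: "l2_inner M g f = cnj (l2_inner M f g)"
  unfolding l2_inner_def by (subst Bochner_Integration.integral_cnj[symmetric]) (simp del: Bochner_Integration.integral_cnj add: mult.commute)

lemma l2_inner_linear_left:
  assumes "f \<in> l2 M" "g \<in> l2 M" "h \<in> l2 M"
  shows "l2_inner M (\<lambda>x. a * f x + b * g x) h = a * l2_inner M f h + b * l2_inner M g h"
proof -
  have "l2_inner M (\<lambda>x. a * f x + b * g x) h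
      = (LINT x|M. a * (f x * cnj (h x)) + b * (g x * cnj (h x)))"
    unfolding l2_inner_def by (rule Bochner_Integration.integral_cong) (auto simp: algebra_simps)
  also have "\<dots> = (LINT x|M. a * (f x * cnj (h x))) + (LINT x|M. b * (g x * cnj (h x)))"
    using assms by (intro Bochner_Integration.integral_add integrable_mult_right l2_integrable_mult_cnj)
  finally show ?thesis
    unfolding l2_inner_def by simp
qed

lemma l2_inner_scale_left:
  assumes "f \<in> l2 M" "h \<in> l2 M"
  shows "l2_inner M (\<lambda>x. a * f x) h = a * l2_inner M f h"
  using l2_inner_linear_left[OF assms(1,1,2), of a 0] by simp

lemma l2_inner_add_left:
  assumes "f \<in> l2 M" "g \<in> l2 M" "h \<in> l2 M"
  shows "l2_inner M (\<lambda>x. f x + g x) h = l2_inner M f h + l2_inner M g h"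
  using l2_inner_linear_left[OF assms, of 1 1] by simp

lemma l2_inner_diff_left:
  assumes "f \<in> l2 M" "g \<in> l2 M" "h \<in> l2 M"
  shows "l2_inner M (\<lambda>x. f x - g x) h = l2_inner M f h - l2_inner M g h"
  using l2_inner_linear_left[OF assms, of 1 "-1"] by simp

lemma l2_inner_diff_right:
  assumes "f \<in> l2 M" "g \<in> l2 M" "h \<in> l2 M"
  shows "l2_inner M h (\<lambda>x. f x - g x) = l2_inner M h f - l2_inner M h g"
  unfolding l2_inner_commute[of M h] using l2_inner_diff_left[OF assms] by simp

lemma l2_inner_add_right:
  assumes "f \<in> l2 M" "g \<in> l2 M" "h \<in> l2 M"
  shows "l2_inner M h (\<lambda>x. f x + g x) = l2_inner M h f + l2_inner M h g"
  unfolding l2_inner_commute[of M h] using l2_inner_add_left[OF assms] by simp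

section \<open>Inequalities in L2 and finite measures\<close>

text \<open>The integral of \<open>(t * cmod (f x) + cmod (g x))\<^sup>2\<close> is a nonnegative
  quadratic polynomial in the real variable \<open>t\<close>. Working with moduli keeps it real; the
  complex inequality follows from it.\<close>

lemma l2_cauchy_schwarz_cmod:
  assumes "f \<in> l2 M" "g \<in> l2 M"
  shows "(LINT x|M. cmod (f x) * cmod (g x)) \<le> l2_norm M f * l2_norm M g"
proof -
  define A B C where "A = (l2_norm M f)\<^sup>2" and "B = (LINT x|M. cmod (f x) * cmod (g x))"
    and "C = (l2_norm M g)\<^sup>2"
  have quad: "0 \<le> t\<^sup>2 * A + 2 * t * B + C" for t
  proof -
    have "0 \<le> (LINT x|M. (t * cmod (f x) + cmod (g x))\<^sup>2)"
      by simp
    also have "\<dots> = (LINT x|M. t\<^sup>2 * (cmod (f x))\<^sup>2 + 2 * t * (cmod (f x) * cmod (g x)) + (cmod (g x))\<^sup>2)"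
      by (rule Bochner_Integration.integral_cong) (auto simp: power2_sum power_mult_distrib)
    also have "\<dots> = t\<^sup>2 * A + 2 * t * B + C"
      unfolding A_def B_def C_def l2_norm_power2
      using l2_square_integrable[OF assms(1)] l2_square_integrable[OF assms(2)]
        l2_integrable_cmod_mult[OF assms]
      by (simp add: Bochner_Integration.integral_add)
    finally show ?thesis .
  qed
  have "B\<^sup>2 \<le> A * C"
  proof (cases "A = 0")
    case True
    have "0 \<le> B"
      unfolding B_def by (intro Bochner_Integration.integral_nonneg) auto
    moreover have "\<not> 0 < B"
    proof
      assume "0 < B"
      \<comment> \<open>Since \<open>A = 0\<close>, the polynomial is affine in \<open>t\<close>,
        and at this point its value is -1.\<close>
      then show False
        using quad[of "- (C + 1) / (2 * B)"] True by (simp add: field_simps)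
    qed
    ultimately show ?thesis using True by simp
  next
    case False
    then have "0 < A" by (simp add: A_def less_le)
    have "0 \<le> (- B / A)\<^sup>2 * A + 2 * (- B / A) * B + C" by (rule quad)
    also have "\<dots> = C - B\<^sup>2 / A"
      using \<open>0 < A\<close> by (simp add: field_simps power2_eq_square)
    finally show ?thesis
      using \<open>0 < A\<close> by (simp add: field_simps)
  qed
  then have "B\<^sup>2 \<le> (l2_norm M f * l2_norm M g)\<^sup>2"
    by (simp add: A_def C_def power_mult_distrib)
  then show ?thesis
    unfolding B_def[symmetric] by (rule power2_le_imp_le) (simp add: l2_norm_nonneg)
qed

lemma l2_cauchy_schwarz:
  assumes "f \<in> l2 M" "g \<in> l2 M"
  shows "cmod (l2_inner M f g) \<le> l2_norm M f * l2_norm M g"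
proof -
  have "cmod (l2_inner M f g) \<le> (LINT x|M. cmod (f x * cnj (g x)))"
    unfolding l2_inner_def by (rule integral_norm_bound)
  also have "\<dots> \<le> l2_norm M f * l2_norm M g"
    using l2_cauchy_schwarz_cmod[OF assms] by (simp add: norm_mult)
  finally show ?thesis .
qed

lemma l2_norm_scale: "l2_norm M (\<lambda>x. c * f x) = cmod c * l2_norm M f"
  unfolding l2_norm_def by (simp add: norm_mult power_mult_distrib real_sqrt_mult)

lemma l2_norm_triangle:
  assumes "f \<in> l2 M" "g \<in> l2 M"
  shows "l2_norm M (\<lambda>x. f x + g x) \<le> l2_norm M f + l2_norm M g"
proof (rule power2_le_imp_le)
  have s: "(\<lambda>x. f x + g x) \<in> l2 M" using assms by (rule l2_add)
  have "complex_of_real ((l2_norm M (\<lambda>x. f x + g x))\<^sup>2)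
      = l2_inner M f f + l2_inner M f g + (l2_inner M g f + l2_inner M g g)"
    unfolding l2_inner_self[symmetric]
    using assms s by (simp add: l2_inner_add_left l2_inner_add_right)
  then have "complex_of_real ((l2_norm M (\<lambda>x. f x + g x))\<^sup>2)
      = of_real ((l2_norm M f)\<^sup>2 + (l2_norm M g)\<^sup>2) + (l2_inner M f g + l2_inner M g f)"
    by (simp add: l2_inner_self)
  then have "(l2_norm M (\<lambda>x. f x + g x))\<^sup>2
      = (l2_norm M f)\<^sup>2 + (l2_norm M g)\<^sup>2 + Re (l2_inner M f g + l2_inner M g f)"
    by (metis Re_complex_of_real plus_complex.sel(1))
  also have "\<dots> \<le> (l2_norm M f)\<^sup>2 + (l2_norm M g)\<^sup>2 + 2 * (l2_norm M f * l2_norm M g)"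
    using l2_cauchy_schwarz[OF assms] l2_cauchy_schwarz[OF assms(2,1)]
      complex_Re_le_cmod[of "l2_inner M f g"] complex_Re_le_cmod[of "l2_inner M g f"]
    by (simp add: mult.commute)
  finally show "(l2_norm M (\<lambda>x. f x + g x))\<^sup>2 \<le> (l2_norm M f + l2_norm M g)\<^sup>2"
    by (simp add: power2_sum)
qed (simp add: l2_norm_nonneg)


lemma l2_bounded:
  assumes "finite_measure M" "f \<in> borel_measurable M"
    and "\<And>x. x \<in> space M \<Longrightarrow> cmod (f x) \<le> c"
  shows "f \<in> l2 M"
proof -
  interpret finite_measure M by fact
  have "integrable M (\<lambda>x. (cmod (f x))\<^sup>2)"
    by (rule integrable_const_bound[of _ "c\<^sup>2"])
      (use assms in \<open>auto intro!: AE_I2 power_mono\<close>)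
  then show ?thesis
    using assms(2) by (simp add: l2_def)
qed

lemma l2_norm_bounded:
  assumes "finite_measure M" "f \<in> borel_measurable M"
    and "\<And>x. x \<in> space M \<Longrightarrow> cmod (f x) \<le> c" "0 \<le> c"
  shows "l2_norm M f \<le> c * sqrt (measure M (space M))"
proof -
  interpret finite_measure M by fact
  have "(LINT x|M. (cmod (f x))\<^sup>2) \<le> (LINT x|M. c\<^sup>2)"
    using l2_bounded[OF assms(1-3)]
    by (intro integral_mono l2_square_integrable) (use assms(3,4) in \<open>auto intro: power_mono\<close>)
  then have "(LINT x|M. (cmod (f x))\<^sup>2) \<le> c\<^sup>2 * measure M (space M)"
    by (simp add: mult.commute)
  then show ?thesis
    unfolding l2_norm_def using assms(4)
    by (metis real_sqrt_le_mono real_sqrt_mult real_sqrt_unique)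
qed

text \<open>The constant 1 is square integrable for a finite measure, and pairing with it embeds L2
  into L1.\<close>

lemma l2_integrable:
  assumes "finite_measure M" "f \<in> l2 M"
  shows "integrable M f"
proof -
  have "(\<lambda>x. 1) \<in> l2 M"
    by (rule l2_bounded[OF assms(1), of _ 1]) auto
  from l2_integrable_mult_cnj[OF assms(2) this] show ?thesis by simp
qed

lemma l2_norm_zero_AE:
  assumes "f \<in> l2 M" "l2_norm M f = 0"
  shows "AE x in M. f x = 0"
proof -
  have "(LINT x|M. (cmod (f x))\<^sup>2) = 0"
    using assms(2) l2_norm_power2[of M f] by simp
  then have "AE x in M. (cmod (f x))\<^sup>2 = 0"
    using integral_nonneg_eq_0_iff_AE[OF l2_square_integrable[OF assms(1)]] by simp
  then show ?thesis by eventually_elim simp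
qed

text \<open>Testing with \<open>u - v\<close> itself yields its norm. This is how a value of
  \<open>adjoint_on\<close>, which is a mere choice, gets identified with an explicit
  integral.\<close>

lemma l2_eq_AE:
  assumes "u \<in> l2 M" "v \<in> l2 M" "\<And>\<phi>. \<phi> \<in> l2 M \<Longrightarrow> l2_inner M \<phi> u = l2_inner M \<phi> v"
  shows "AE x in M. u x = v x"
proof -
  have d: "(\<lambda>x. u x - v x) \<in> l2 M" using assms(1,2) by (rule l2_diff)
  have "of_real ((l2_norm M (\<lambda>x. u x - v x))\<^sup>2) = (0::complex)"
    unfolding l2_inner_self[symmetric] l2_inner_diff_right[OF assms(1,2) d] using assms(3)[OF d] by simp
  then have "l2_norm M (\<lambda>x. u x - v x) = 0" by simp
  from l2_norm_zero_AE[OF d this] show ?thesis by simp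
qed

subsection \<open>Boundaries of class \<open>C\<^sup>2\<close>\<close>

text \<open>A sufficient condition for finite Hausdorff measure: one bound \<open>L\<close> serves
  every mesh size \<open>d\<close>. Covers are lists so that the cover of a union is a
  concatenation, whose diameters simply add.\<close>

definition finite_length :: "plane set \<Rightarrow> bool" where
  "finite_length A \<longleftrightarrow> (\<exists>L. \<forall>d>0. \<exists>Us. A \<subseteq> \<Union>(set Us) \<and>
     (\<forall>V\<in>set Us. bounded V \<and> diameter V \<le> d) \<and> sum_list (map diameter Us) \<le> L)"

lemma finite_length_hausdorff1_finite:
  assumes "finite_length A"
  shows "hausdorff1 A < \<infinity>"
proof -
  obtain L where L: "\<And>d. d > 0 \<Longrightarrow> \<exists>Us. A \<subseteq> \<Union>(set Us) \<and>
     (\<forall>V\<in>set Us. bounded V \<and> diameter V \<le> d) \<and> sum_list (map diameter Us) \<le> L"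
    using assms unfolding finite_length_def by auto
  have "hausdorff1 A \<le> ennreal L"
    unfolding hausdorff1_def
  proof (rule SUP_least)
    fix d :: real assume "d \<in> {0<..}"
    then have "0 < d" by simp
    from L[OF this] obtain Us where Us: "A \<subseteq> \<Union>(set Us)"
      "\<forall>V\<in>set Us. bounded V \<and> diameter V \<le> d" "sum_list (map diameter Us) \<le> L"
      by auto
    \<comment> \<open>\<open>hausdorff1\<close> asks for a sequence of sets; the list is padded with
      empty sets, whose diameter is 0.\<close>
    define V where "V i = (if i < length Us then Us ! i else {})" for i
    have "(\<Sum>i. ennreal (diameter (V i))) = (\<Sum>i<length Us. ennreal (diameter (V i)))"
      by (rule suminf_finite) (auto simp: V_def)
    also have "\<dots> = ennreal (\<Sum>i<length Us. diameter (V i))"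
      by (rule sum_ennreal) (use Us(2) in \<open>auto simp: V_def intro: diameter_ge_0\<close>)
    also have "(\<Sum>i<length Us. diameter (V i)) = sum_list (map diameter Us)"
      by (simp add: V_def sum_list_sum_nth atLeast0LessThan)
    finally have "(\<Sum>i. ennreal (diameter (V i))) \<le> ennreal L"
      using Us(3) by (simp add: ennreal_leI)
    moreover have "V \<in> {U. A \<subseteq> (\<Union>i. U i) \<and> (\<forall>i. bounded (U i) \<and> diameter (U i) \<le> d)}"
    proof -
      have "A \<subseteq> (\<Union>i. V i)"
      proof
        fix x assume "x \<in> A"
        then obtain W where "W \<in> set Us" "x \<in> W" using Us(1) by blast
        then obtain i where "i < length Us" "Us ! i = W" by (metis in_set_conv_nth)
        then show "x \<in> (\<Union>i. V i)" using \<open>x \<in> W\<close> by (auto simp: V_def intro!: exI[of _ i])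
      qed
      moreover have "bounded (V i) \<and> diameter (V i) \<le> d" for i
        using Us(2) \<open>0 < d\<close> by (auto simp: V_def)
      ultimately show ?thesis by simp
    qed
    ultimately show "(INF U\<in>{U. A \<subseteq> (\<Union>i. U i) \<and> (\<forall>i. bounded (U i) \<and> diameter (U i) \<le> d)}.
        \<Sum>i. ennreal (diameter (U i))) \<le> ennreal L"
      by (blast intro: INF_lower2)
  qed
  then show ?thesis
    using le_less_trans[OF _ ennreal_less_top] by (simp add: infinity_ennreal_def)
qed

lemma finite_length_subset: "finite_length B \<Longrightarrow> A \<subseteq> B \<Longrightarrow> finite_length A"
  unfolding finite_length_def by (meson order_trans)

lemma finite_length_empty: "finite_length {}"
  unfolding finite_length_def by (rule exI[of _ 0], intro allI impI, rule exI[of _ "[]"]) simp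

lemma finite_length_Un:
  assumes "finite_length A" "finite_length B"
  shows "finite_length (A \<union> B)"
proof -
  obtain L where L: "\<And>d. d > 0 \<Longrightarrow> \<exists>Us. A \<subseteq> \<Union>(set Us) \<and>
     (\<forall>V\<in>set Us. bounded V \<and> diameter V \<le> d) \<and> sum_list (map diameter Us) \<le> L"
    using assms(1) unfolding finite_length_def by auto
  obtain L' where L': "\<And>d. d > 0 \<Longrightarrow> \<exists>Us. B \<subseteq> \<Union>(set Us) \<and>
     (\<forall>V\<in>set Us. bounded V \<and> diameter V \<le> d) \<and> sum_list (map diameter Us) \<le> L'"
    using assms(2) unfolding finite_length_def by auto
  have "\<exists>Us. A \<union> B \<subseteq> \<Union>(set Us) \<and> (\<forall>V\<in>set Us. bounded V \<and> diameter V \<le> d) \<and>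
     sum_list (map diameter Us) \<le> L + L'" if d: "d > 0" for d
  proof -
    obtain Us where Us: "A \<subseteq> \<Union>(set Us)"
      "\<forall>V\<in>set Us. bounded V \<and> diameter V \<le> d" "sum_list (map diameter Us) \<le> L"
      using L[OF d] by auto
    obtain Vs where Vs: "B \<subseteq> \<Union>(set Vs)"
      "\<forall>V\<in>set Vs. bounded V \<and> diameter V \<le> d" "sum_list (map diameter Vs) \<le> L'"
      using L'[OF d] by auto
    show ?thesis
      by (rule exI[of _ "Us @ Vs"]) (use Us Vs in auto)
  qed
  then show ?thesis
    unfolding finite_length_def by blast
qed

lemma finite_length_Union: "finite \<A> \<Longrightarrow> (\<And>A. A \<in> \<A> \<Longrightarrow> finite_length A) \<Longrightarrow> finite_length (\<Union>\<A>)"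
  by (induction \<A> rule: finite_induct) (auto simp: finite_length_empty finite_length_Un)

lemma finite_length_compact_local:
  assumes "compact S" "\<And>x. x \<in> S \<Longrightarrow> \<exists>r>0. finite_length (S \<inter> ball x r)"
  shows "finite_length S"
proof -
  obtain r where r: "\<And>x. x \<in> S \<Longrightarrow> 0 < r x" "\<And>x. x \<in> S \<Longrightarrow> finite_length (S \<inter> ball x (r x))"
    using assms(2) by metis
  obtain C where C: "C \<subseteq> S" "finite C" "S \<subseteq> (\<Union>x\<in>C. ball x (r x))"
    by (rule compactE_image[OF assms(1), of S "\<lambda>x. ball x (r x)"]) (use r(1) in force)+
  have "finite_length (\<Union>((\<lambda>x. S \<inter> ball x (r x)) ` C))"
    by (rule finite_length_Union) (use C(1,2) r(2) in auto)
  then show ?thesis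
    by (rule finite_length_subset) (use C(3) in auto)
qed

text \<open>Cut the interval into \<open>N\<close> pieces of length \<open>w\<close> with
  \<open>L * w \<le> d\<close>. The image of each has diameter at most \<open>L * w\<close>, and
  \<open>N\<close> of these add up to \<open>L * (b - a)\<close>, whatever \<open>d\<close>
  is.\<close>

lemma finite_length_lipschitz_image:
  fixes \<gamma> :: "real \<Rightarrow> plane"
  assumes "L-lipschitz_on {a..b} \<gamma>"
  shows "finite_length (\<gamma> ` {a..b})"
proof (cases "a \<le> b")
  case False
  then have "{a..b} = {}" by simp
  then show ?thesis by (simp only: image_empty finite_length_empty)
next
  case True
  have "0 \<le> L" using assms by (rule lipschitz_on_nonneg)
  have "\<exists>Us. \<gamma> ` {a..b} \<subseteq> \<Union>(set Us) \<and> (\<forall>V\<in>set Us. bounded V \<and> diameter V \<le> d) \<and>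
     sum_list (map diameter Us) \<le> L * (b - a)" if "d > 0" for d
  proof -
    obtain N :: nat where N: "L * (b - a) / d < real N" using reals_Archimedean2 by blast
    have "0 \<le> L * (b - a) / d" using \<open>0 \<le> L\<close> True that by simp
    then have "0 < N" using N by (intro Nat.gr0I) auto
    define w where "w = (b - a) / N"
    have w: "0 \<le> w" "real N * w = b - a" using True \<open>0 < N\<close> by (auto simp: w_def)
    have "L * w \<le> d"
      using N that \<open>0 < N\<close> by (simp add: w_def field_simps)
    define V where "V i = \<gamma> ` ({a..b} \<inter> {a + real i * w .. a + real (Suc i) * w})" for i
    have diam: "diameter (V i) \<le> L * w" for i
    proof (rule diameter_le)
      show "V i \<noteq> {} \<or> 0 \<le> L * w" using \<open>0 \<le> L\<close> w by simp
      fix x y assume "x \<in> V i" "y \<in> V i"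
      then obtain s t where st: "x = \<gamma> s" "y = \<gamma> t" "s \<in> {a..b}" "t \<in> {a..b}"
        "s \<in> {a + real i * w .. a + real (Suc i) * w}" "t \<in> {a + real i * w .. a + real (Suc i) * w}"
        by (auto simp: V_def)
      have "dist s t \<le> w" using st(5,6) by (auto simp: dist_real_def algebra_simps)
      then have "L * dist s t \<le> L * w" using \<open>0 \<le> L\<close> by (rule mult_left_mono)
      moreover have "dist x y \<le> L * dist s t"
        unfolding st(1,2) using assms st(3,4) by (rule lipschitz_onD)
      ultimately show "norm (x - y) \<le> L * w" by (simp add: dist_norm)
    qed
    have bdd: "bounded (V i)" for i
    proof -
      have "continuous_on {a..b} \<gamma>" using assms by (rule lipschitz_on_continuous_on)
      then have "bounded (\<gamma> ` {a..b})" by (intro compact_imp_bounded compact_continuous_image) auto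
      then show ?thesis by (rule bounded_subset) (auto simp: V_def)
    qed
    have cover: "\<gamma> ` {a..b} \<subseteq> (\<Union>i<N. V i)"
    proof
      fix x assume "x \<in> \<gamma> ` {a..b}"
      then obtain t where t: "t \<in> {a..b}" "x = \<gamma> t" by auto
      show "x \<in> (\<Union>i<N. V i)"
      \<comment> \<open>The endpoint belongs to the last piece \<open>N - 1\<close>, where the floor
        used in the other case could give \<open>N\<close>. This case also covers
        \<open>a = b\<close>, where \<open>w = 0\<close> forbids the division.\<close>
      proof (cases "t = b")
        case True
        have "real (Suc (N - 1)) = real N" using \<open>0 < N\<close> by simp
        moreover have "real (N - 1) * w \<le> real N * w" using w by (intro mult_right_mono) auto
        ultimately have "t \<in> {a + real (N - 1) * w .. a + real (Suc (N - 1)) * w}"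
          using w True by (metis atLeastAtMost_iff add_left_mono add_diff_cancel_left' le_add_diff_inverse order_refl diff_add_cancel add.commute)
        then show ?thesis using t \<open>0 < N\<close> by (auto simp: V_def intro!: bexI[of _ "N - 1"])
      next
        case False
        then have "t < b" "a < b" using t by auto
        then have "0 < w" using \<open>0 < N\<close> by (simp add: w_def)
        define i where "i = nat \<lfloor>(t - a) / w\<rfloor>"
        have "0 \<le> (t - a) / w" using t \<open>0 < w\<close> by simp
        then have i: "real i \<le> (t - a) / w" "(t - a) / w < real i + 1"
          unfolding i_def by linarith+
        have "real i * w \<le> t - a" "t - a \<le> (real i + 1) * w"
          using i \<open>0 < w\<close> by (auto simp: field_simps)
        moreover have "real i * w < real N * w"
          using calculation(1) \<open>t < b\<close> w(2) by linarith
        then have "i < N" using \<open>0 < w\<close> by simp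
        ultimately have "t \<in> {a..b} \<inter> {a + real i * w .. a + real (Suc i) * w}" "i < N"
          using t by (auto simp: algebra_simps)
        then show ?thesis unfolding V_def using t(2) by blast
      qed
    qed
    have le_d: "diameter (V i) \<le> d" for i
      using diam \<open>L * w \<le> d\<close> by (rule order_trans)
    have "sum_list (map diameter (map V [0..<N])) \<le> (\<Sum>i<N. L * w)"
      using diam by (simp add: comp_def interv_sum_list_conv_sum_set_nat atLeast0LessThan sum_mono
          flip: sum_constant del: sum_constant)
    also have "\<dots> = L * (b - a)" using w(2) by simp
    finally show ?thesis
      using cover bdd le_d
      by (intro exI[of _ "map V [0..<N]"]) (auto simp: atLeast0LessThan)
  qed
  then show ?thesis
    unfolding finite_length_def by blast
qed

lemma finite_length_differentiable_image:
  fixes \<gamma> :: "real \<Rightarrow> plane"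
  assumes "\<And>t. (\<gamma> has_vector_derivative \<gamma>' t) (at t)" "continuous_on UNIV \<gamma>'"
  shows "finite_length (\<gamma> ` {a..b})"
proof -
  have "compact (\<gamma>' ` {a..b})"
    using assms(2) by (intro compact_continuous_image) (auto intro: continuous_on_subset)
  then obtain L where L: "0 \<le> L" "\<And>t. t \<in> {a..b} \<Longrightarrow> norm (\<gamma>' t) \<le> L"
    by (metis compact_imp_bounded bounded_pos image_eqI less_imp_le)
  have "L-lipschitz_on {a..b} \<gamma>"
  proof (rule lipschitz_onI)
    fix s t assume st: "s \<in> {a..b}" "t \<in> {a..b}"
    show "dist (\<gamma> s) (\<gamma> t) \<le> L * dist s t"
      unfolding dist_norm
    proof (rule differentiable_bound[of "{a..b}" \<gamma> "\<lambda>t h. h *\<^sub>R \<gamma>' t"])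
      fix x assume x: "x \<in> {a..b}"
      show "(\<gamma> has_derivative (\<lambda>h. h *\<^sub>R \<gamma>' x)) (at x within {a..b})"
        using assms(1)[of x] unfolding has_vector_derivative_def by (rule has_derivative_at_withinI)
      show "onorm (\<lambda>h. h *\<^sub>R \<gamma>' x) \<le> L"
        by (rule onorm_bound) (use L x in \<open>auto simp: mult.commute[of "\<bar>_\<bar>"] intro: mult_right_mono\<close>)
    qed (use st in auto)
  qed (fact L(1))
  then show ?thesis by (rule finite_length_lipschitz_image)
qed

section \<open>The circle and local graphs\<close>

lemma plane_orthonormal_expand:
  fixes e n y :: plane
  assumes "norm e = 1" "norm n = 1" "e \<bullet> n = 0"
  shows "y = (y \<bullet> e) *\<^sub>R e + (y \<bullet> n) *\<^sub>R n"
proof -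
  have 1: "e$1 * e$1 + e$2 * e$2 = 1" "n$1 * n$1 + n$2 * n$2 = 1" "e$1 * n$1 + e$2 * n$2 = 0"
    using assms by (simp_all add: norm_eq_1 inner_vec_def sum_2)
  \<comment> \<open>In the plane \<open>n\<close> is \<open>e\<close> turned by a right angle, up to
    a sign; squares and products of the coordinates do not see that sign.\<close>
  have "n$1 * n$1 = e$2 * e$2" "n$2 * n$2 = e$1 * e$1" "n$1 * n$2 = - (e$1 * e$2)"
    using 1 by algebra+
  then have "y$1 = (y$1 * e$1 + y$2 * e$2) * e$1 + (y$1 * n$1 + y$2 * n$2) * n$1"
    "y$2 = (y$1 * e$1 + y$2 * e$2) * e$2 + (y$1 * n$1 + y$2 * n$2) * n$2"
    using 1 by algebra+
  then show ?thesis
    by (simp add: vec_eq_iff forall_2 inner_vec_def sum_2)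
qed

text \<open>Needed for the outer circle: the length of the boundary of \<open>Dc\<close> is assumed
  finite, and that of \<open>Da\<close> comes from its local graphs.\<close>

lemma finite_length_sphere: "finite_length (sphere (0::plane) R)"
proof -
  define e n :: plane where "e = axis 1 1" and "n = axis 2 1"
  have en: "norm e = 1" "norm n = 1" "e \<bullet> n = 0"
    by (simp_all add: e_def n_def inner_axis_axis)
  define \<gamma> where "\<gamma> t = (R * cos t) *\<^sub>R e + (R * sin t) *\<^sub>R n" for t
  have "finite_length (\<gamma> ` {0..2*pi})"
  proof (rule finite_length_differentiable_image)
    show "(\<gamma> has_vector_derivative (- R * sin t) *\<^sub>R e + (R * cos t) *\<^sub>R n) (at t)" for t
      unfolding \<gamma>_def by (auto intro!: derivative_eq_intros simp: mult.commute)
  qed (intro continuous_intros)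
  moreover have "sphere 0 R \<subseteq> \<gamma> ` {0..2*pi}"
  proof
    fix y :: plane assume "y \<in> sphere 0 R"
    then have R: "norm y = R" by simp
    have y: "y = (y \<bullet> e) *\<^sub>R e + (y \<bullet> n) *\<^sub>R n"
      using en by (rule plane_orthonormal_expand)
    have "y \<bullet> y = (y \<bullet> e)\<^sup>2 + (y \<bullet> n)\<^sup>2"
      by (subst y) (use en in \<open>simp add: inner_simps norm_eq_1 power2_eq_square inner_commute\<close>)
    then have sq: "(y \<bullet> e)\<^sup>2 + (y \<bullet> n)\<^sup>2 = R\<^sup>2"
      using R by (simp add: dot_square_norm)
    show "y \<in> \<gamma> ` {0..2*pi}"
    proof (cases "R = 0")
      case True
      then show ?thesis using R by (auto simp: \<gamma>_def intro!: image_eqI[of _ _ 0])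
    next
      case False
      then have "((y \<bullet> e) / R)\<^sup>2 + ((y \<bullet> n) / R)\<^sup>2 = 1"
        using sq by (simp add: power_divide add_divide_distrib[symmetric])
      then obtain t where "0 \<le> t" "t < 2 * pi" "(y \<bullet> e) / R = cos t" "(y \<bullet> n) / R = sin t"
        using sincos_total_2pi by metis
      then have "y \<bullet> e = R * cos t" "y \<bullet> n = R * sin t" "t \<in> {0..2*pi}"
        using False by (auto simp: field_simps)
      moreover from calculation have "y = \<gamma> t" using y by (simp add: \<gamma>_def)
      ultimately show ?thesis by (intro image_eqI)
    qed
  qed
  ultimately show ?thesis by (rule finite_length_subset)
qed

text \<open>Off the graph one of the two strict inequalities holds on a whole neighbourhood, which
  then either misses \<open>D\<close> or lies in \<open>D\<close>. Neither can happen at a frontier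
  point.\<close>

lemma frontier_local_graph:
  fixes h :: "real \<Rightarrow> real" and n e x :: plane
  assumes h: "continuous_on UNIV h"
    and D: "D \<inter> ball x r = {y \<in> ball x r. y \<bullet> n < h (y \<bullet> e)}"
    and y: "y \<in> frontier D" "y \<in> ball x r"
  shows "y \<bullet> n = h (y \<bullet> e)"
proof (rule antisym; rule leI; rule notI)
  have cont: "continuous_on UNIV (\<lambda>y. h (y \<bullet> e))"
    by (rule continuous_on_compose2[OF h]) (auto intro!: continuous_intros)
  have mem: "z \<in> D \<longleftrightarrow> z \<bullet> n < h (z \<bullet> e)" if "z \<in> ball x r" for z
  proof -
    have "z \<in> D \<inter> ball x r \<longleftrightarrow> z \<in> {y \<in> ball x r. y \<bullet> n < h (y \<bullet> e)}" by (simp only: D)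
    then show ?thesis using that by simp
  qed
  {
    assume "h (y \<bullet> e) < y \<bullet> n"
    define W where "W = ball x r \<inter> {y. h (y \<bullet> e) < y \<bullet> n}"
    have "y \<in> W" using y \<open>h (y \<bullet> e) < y \<bullet> n\<close> by (simp add: W_def)
    have "open W"
      unfolding W_def using cont by (intro open_Int open_ball open_Collect_less continuous_intros)
    moreover have "W \<inter> D = {}" using mem by (fastforce simp: W_def)
    ultimately have "W \<inter> closure D = {}" by (simp add: open_Int_closure_eq_empty)
    then have "y \<notin> closure D" using \<open>y \<in> W\<close> by blast
    then show False using y by (simp add: frontier_def)
  next
    assume "y \<bullet> n < h (y \<bullet> e)"
    then have "y \<in> ball x r \<inter> {y. y \<bullet> n < h (y \<bullet> e)}" using y by simp
    moreover have "open (ball x r \<inter> {y. y \<bullet> n < h (y \<bullet> e)})"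
      using cont by (intro open_Int open_ball open_Collect_less continuous_intros)
    moreover have "ball x r \<inter> {y. y \<bullet> n < h (y \<bullet> e)} \<subseteq> D" using mem by blast
    ultimately have "y \<in> interior D" by (meson interiorI)
    then show False using y by (simp add: frontier_def)
  }
qed

text \<open>Within a ball of radius \<open>r\<close> the coordinate along \<open>e\<close> varies by
  less than \<open>r\<close>, so the frontier there lies on a C1 arc over a compact interval;
  compactness leaves finitely many arcs.\<close>

lemma C2_boundary_finite_length:
  assumes "C2_boundary D" "bounded D"
  shows "finite_length (frontier D)"
proof (rule finite_length_compact_local)
  show "compact (frontier D)" using assms(2) by (rule compact_frontier_bounded)
  fix x assume "x \<in> frontier D"
  then obtain r e n h h' h'' where *: "0 < r" "norm e = 1" "norm n = 1" "e \<bullet> n = 0"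
    "\<forall>t. (h has_real_derivative h' t) (at t)" "\<forall>t. (h' has_real_derivative h'' t) (at t)"
    "D \<inter> ball x r = {y \<in> ball x r. y \<bullet> n < h (y \<bullet> e)}"
    using assms(1) unfolding C2_boundary_def by meson
  have h: "continuous_on UNIV h" and h': "continuous_on UNIV h'"
    using *(5,6) by (meson DERIV_isCont continuous_at_imp_continuous_on)+
  define \<gamma> where "\<gamma> t = t *\<^sub>R e + h t *\<^sub>R n" for t
  have "finite_length (\<gamma> ` {x \<bullet> e - r..x \<bullet> e + r})"
  proof (rule finite_length_differentiable_image)
    show "(\<gamma> has_vector_derivative e + h' t *\<^sub>R n) (at t)" for t
      unfolding \<gamma>_def using *(5) by (auto intro!: derivative_eq_intros)
  qed (intro continuous_intros h')
  moreover have "frontier D \<inter> ball x r \<subseteq> \<gamma> ` {x \<bullet> e - r..x \<bullet> e + r}"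
  proof
    fix y assume y: "y \<in> frontier D \<inter> ball x r"
    then have "y \<bullet> n = h (y \<bullet> e)"
      using frontier_local_graph[OF h *(7)] by blast
    then have "y = \<gamma> (y \<bullet> e)"
      unfolding \<gamma>_def using plane_orthonormal_expand[OF *(2-4), of y] by simp
    moreover have "\<bar>(y - x) \<bullet> e\<bar> \<le> norm (y - x) * norm e" by (rule Cauchy_Schwarz_ineq2)
    then have "y \<bullet> e \<in> {x \<bullet> e - r..x \<bullet> e + r}"
      using y *(2) by (auto simp: inner_simps dist_norm norm_minus_commute abs_le_iff)
    ultimately show "y \<in> \<gamma> ` {x \<bullet> e - r..x \<bullet> e + r}" by blast
  qed
  ultimately have "finite_length (frontier D \<inter> ball x r)" by (rule finite_length_subset)
  then show "\<exists>r>0. finite_length (frontier D \<inter> ball x r)" using *(1) by blast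
qed

section \<open>The outward normal\<close>

text \<open>If two different unit vectors \<open>m\<close> and \<open>n\<close> qualified, the
  direction \<open>m - n\<close> would have a negative product with \<open>n\<close> and a positive
  one with \<open>m\<close>, so it would point both into \<open>D\<close> and out of it.\<close>

lemma outward_normal_eqI:
  assumes "norm n = 1"
    and "\<And>v. v \<bullet> n < 0 \<Longrightarrow> (\<forall>\<^sub>F t in at_right 0. x + t *\<^sub>R v \<in> D)"
    and "\<And>v. v \<bullet> n > 0 \<Longrightarrow> (\<forall>\<^sub>F t in at_right 0. x + t *\<^sub>R v \<notin> D)"
  shows "outward_normal D x = n"
  unfolding outward_normal_def
proof (rule the_equality)
  fix m assume m: "norm m = 1 \<and>
     (\<forall>v. v \<bullet> m < 0 \<longrightarrow> (\<forall>\<^sub>F t in at_right 0. x + t *\<^sub>R v \<in> D)) \<and>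
     (\<forall>v. v \<bullet> m > 0 \<longrightarrow> (\<forall>\<^sub>F t in at_right 0. x + t *\<^sub>R v \<notin> D))"
  show "m = n"
  proof (rule ccontr)
    assume "m \<noteq> n"
    then have "0 < (m - n) \<bullet> (m - n)" by simp
    moreover have "m \<bullet> m = 1" "n \<bullet> n = 1" using m assms(1) by (simp_all add: dot_square_norm)
    ultimately have "(m - n) \<bullet> n < 0" "(m - n) \<bullet> m > 0"
      by (simp_all add: inner_simps inner_commute)
    then have "\<forall>\<^sub>F t in at_right (0::real). x + t *\<^sub>R (m - n) \<in> D"
      "\<forall>\<^sub>F t in at_right (0::real). x + t *\<^sub>R (m - n) \<notin> D"
      using m assms(2) by blast+
    then have "\<forall>\<^sub>F t in at_right (0::real). False" by eventually_elim simp
    then show False by simp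
  qed
qed (use assms in blast)

lemma outward_normal_graph:
  fixes h h' :: "real \<Rightarrow> real"
  assumes en: "norm e = 1" "norm n = 1" "e \<bullet> n = 0"
    and h: "\<forall>t. (h has_real_derivative h' t) (at t)"
    and D: "D \<inter> ball x r = {y \<in> ball x r. y \<bullet> n < h (y \<bullet> e)}"
    and y: "y \<in> frontier D" "y \<in> ball x r"
  shows "outward_normal D y = (1 / sqrt (1 + (h' (y \<bullet> e))\<^sup>2)) *\<^sub>R (n - h' (y \<bullet> e) *\<^sub>R e)"
proof (rule outward_normal_eqI)
  define p where "p = h' (y \<bullet> e)"
  have pos: "0 < sqrt (1 + p\<^sup>2)" by (simp add: add_pos_nonneg)
  have "(n - p *\<^sub>R e) \<bullet> (n - p *\<^sub>R e) = 1 + p\<^sup>2"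
    using en by (simp add: inner_simps norm_eq_1 inner_commute power2_eq_square)
  then have "norm (n - p *\<^sub>R e) = sqrt (1 + p\<^sup>2)" by (simp add: norm_eq_sqrt_inner)
  then show "norm ((1 / sqrt (1 + (h' (y \<bullet> e))\<^sup>2)) *\<^sub>R (n - h' (y \<bullet> e) *\<^sub>R e)) = 1"
    using pos unfolding p_def[symmetric] by simp
  have "continuous_on UNIV h" using h by (meson DERIV_isCont continuous_at_imp_continuous_on)
  from frontier_local_graph[OF this D y] have y0: "y \<bullet> n = h (y \<bullet> e)" .
  \<comment> \<open>\<open>f v t\<close> is the height of \<open>y + t v\<close> above the graph,
    measured along \<open>n\<close>. Inside the ball its sign decides membership in
    \<open>D\<close>, and its derivative at 0 is a positive multiple of the product of
    \<open>v\<close> with the claimed normal.\<close>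
  define f where "f v t = (y + t *\<^sub>R v) \<bullet> n - h ((y + t *\<^sub>R v) \<bullet> e)" for v and t :: real
  have f0: "f v 0 = 0" for v by (simp add: f_def y0)
  have deriv: "(f v has_real_derivative (v \<bullet> n - p * (v \<bullet> e))) (at 0)" for v
  proof -
    have "((\<lambda>t. h ((y + t *\<^sub>R v) \<bullet> e)) has_real_derivative (p * (v \<bullet> e))) (at 0)"
      unfolding p_def
      by (rule DERIV_chain2[where g = "\<lambda>t. (y + t *\<^sub>R v) \<bullet> e"])
        (use h in \<open>auto simp: inner_simps intro!: derivative_eq_intros\<close>)
    moreover have "((\<lambda>t. (y + t *\<^sub>R v) \<bullet> n) has_real_derivative (v \<bullet> n)) (at 0)"
      by (auto simp: inner_simps intro!: derivative_eq_intros)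
    ultimately show ?thesis unfolding f_def by (rule DERIV_diff[rotated])
  qed
  have ball: "\<forall>\<^sub>F t in at_right 0. y + t *\<^sub>R v \<in> ball x r" for v
  proof -
    have "((\<lambda>t. y + t *\<^sub>R v) \<longlongrightarrow> y + 0 *\<^sub>R v) (at_right 0)" by (intro tendsto_intros)
    then show ?thesis using y(2) by (auto simp: tendsto_def)
  qed
  have mem: "y + t *\<^sub>R v \<in> D \<longleftrightarrow> f v t < 0" if "y + t *\<^sub>R v \<in> ball x r" for v t
  proof -
    have "y + t *\<^sub>R v \<in> D \<inter> ball x r \<longleftrightarrow> y + t *\<^sub>R v \<in> {y \<in> ball x r. y \<bullet> n < h (y \<bullet> e)}"
      by (simp only: D)
    then show ?thesis using that by (simp add: f_def)
  qed
  have inner: "v \<bullet> ((1 / sqrt (1 + (h' (y \<bullet> e))\<^sup>2)) *\<^sub>R (n - h' (y \<bullet> e) *\<^sub>R e))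
     = (v \<bullet> n - p * (v \<bullet> e)) / sqrt (1 + p\<^sup>2)" for v
    by (simp add: p_def inner_simps)
  {
    fix v assume "v \<bullet> ((1 / sqrt (1 + (h' (y \<bullet> e))\<^sup>2)) *\<^sub>R (n - h' (y \<bullet> e) *\<^sub>R e)) < 0"
    then have "v \<bullet> n - p * (v \<bullet> e) < 0" unfolding inner using pos by (simp add: divide_less_0_iff)
    from has_real_derivative_neg_dec_right[OF deriv this] obtain d where
      "d > 0" "\<And>t. t > 0 \<Longrightarrow> t < d \<Longrightarrow> f v t < 0" using f0 by auto
    then have "\<forall>\<^sub>F t in at_right 0. f v t < 0" unfolding eventually_at_right_field by blast
    then show "\<forall>\<^sub>F t in at_right 0. y + t *\<^sub>R v \<in> D"
      using ball[of v] by eventually_elim (simp add: mem)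
  next
    fix v assume "v \<bullet> ((1 / sqrt (1 + (h' (y \<bullet> e))\<^sup>2)) *\<^sub>R (n - h' (y \<bullet> e) *\<^sub>R e)) > 0"
    then have "0 < v \<bullet> n - p * (v \<bullet> e)" unfolding inner using pos by (simp add: zero_less_divide_iff)
    from has_real_derivative_pos_inc_right[OF deriv this] obtain d where
      "d > 0" "\<And>t. t > 0 \<Longrightarrow> t < d \<Longrightarrow> 0 < f v t" using f0 by auto
    then have "\<forall>\<^sub>F t in at_right 0. 0 < f v t" unfolding eventually_at_right_field by blast
    then show "\<forall>\<^sub>F t in at_right 0. y + t *\<^sub>R v \<notin> D"
      using ball[of v] by eventually_elim (simp add: mem)
  }
qed

lemma continuous_on_outward_normal:
  assumes "C2_boundary D"
  shows "continuous_on (frontier D) (outward_normal D)"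
  unfolding continuous_on_eq_continuous_within
proof
  fix x assume x: "x \<in> frontier D"
  then obtain r e n h h' h'' where *: "0 < r" "norm e = 1" "norm n = 1" "e \<bullet> n = 0"
    "\<forall>t. (h has_real_derivative h' t) (at t)" "\<forall>t. (h' has_real_derivative h'' t) (at t)"
    "D \<inter> ball x r = {y \<in> ball x r. y \<bullet> n < h (y \<bullet> e)}"
    using assms unfolding C2_boundary_def by meson
  have h': "continuous_on UNIV h'"
    using *(6) by (meson DERIV_isCont continuous_at_imp_continuous_on)
  have "continuous_on UNIV (\<lambda>y. h' (y \<bullet> e))"
    by (rule continuous_on_compose2[OF h']) (auto intro!: continuous_intros)
  then have "continuous_on UNIV (\<lambda>y. (1 / sqrt (1 + (h' (y \<bullet> e))\<^sup>2)) *\<^sub>R (n - h' (y \<bullet> e) *\<^sub>R e))"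
    by (intro continuous_intros) (auto simp: add_nonneg_eq_0_iff)
  then have "continuous (at x within frontier D)
      (\<lambda>y. (1 / sqrt (1 + (h' (y \<bullet> e))\<^sup>2)) *\<^sub>R (n - h' (y \<bullet> e) *\<^sub>R e))"
    using continuous_on_eq_continuous_at[OF open_UNIV] continuous_at_imp_continuous_at_within by blast
  then show "continuous (at x within frontier D) (outward_normal D)"
    by (rule continuous_transform_within[OF _ *(1) x])
      (use outward_normal_graph[OF *(2-5) *(7)] in \<open>simp add: dist_commute\<close>)
qed

section \<open>Arc length as a finite measure\<close>

lemma sets_measure_of_borel: "sets (measure_of UNIV (sets borel) \<mu>) = sets borel"
  using sets.sets_measure_of_eq[of borel \<mu>] by simp

text \<open>If \<^const>\<open>hausdorff1\<close> were not a measure, \<^const>\<open>arc_measure\<close> would be the zero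
  measure, which is finite as well; so countable additivity is not needed.\<close>

lemma finite_measure_arc_measure:
  assumes "hausdorff1 (frontier D) < \<infinity>"
  shows "finite_measure (arc_measure D)"
proof (rule finite_measureI)
  have "emeasure (measure_of UNIV (sets borel) hausdorff1) (frontier D) \<noteq> \<infinity>"
    using assms by (auto simp: emeasure_measure_of_conv)
  moreover have "frontier D \<in> sets (measure_of UNIV (sets borel) hausdorff1)"
    by (simp add: sets_measure_of_borel)
  ultimately show "emeasure (arc_measure D) (space (arc_measure D)) \<noteq> \<infinity>"
    by (simp add: arc_measure_def emeasure_restrict_space space_restrict_space)
qed

lemma sets_arc_measure: "sets (arc_measure D) = sets (restrict_space borel (frontier D))"
  unfolding arc_measure_def by (rule sets_restrict_space_cong) (rule sets_measure_of_borel)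

subsection \<open>The kernel of the double layer potential\<close>

text \<open>Domination by the exponential series makes the power series converge everywhere.
  Termwise differentiation is applied twice: once for the derivative, once more for its
  continuity.\<close>

lemma entire_series_C1:
  fixes c :: "nat \<Rightarrow> real"
  assumes "\<And>m. \<bar>c m\<bar> \<le> 1 / fact m"
  obtains f' where "\<And>z. ((\<lambda>z. \<Sum>m. c m * z ^ m) has_real_derivative f' z) (at z)"
    and "continuous_on UNIV f'"
proof
  have sm: "summable (\<lambda>m. c m * z ^ m)" for z
  proof (rule summable_comparison_test)
    show "summable (\<lambda>m. inverse (fact m) * \<bar>z\<bar> ^ m)" by (rule summable_exp)
    have "norm (c m * z ^ m) \<le> inverse (fact m) * \<bar>z\<bar> ^ m" for m
      using mult_right_mono[OF assms[of m], of "\<bar>z\<bar> ^ m"]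
      by (simp add: abs_mult power_abs inverse_eq_divide)
    then show "\<exists>N. \<forall>m\<ge>N. norm (c m * z ^ m) \<le> inverse (fact m) * \<bar>z\<bar> ^ m" by blast
  qed
  show "((\<lambda>z. \<Sum>m. c m * z ^ m) has_real_derivative (\<Sum>m. diffs c m * z ^ m)) (at z)" for z
    using sm by (rule termdiffs_strong_converges_everywhere)
  have "summable (\<lambda>m. diffs c m * z ^ m)" for z
    using sm by (rule termdiff_converges_all)
  then have "((\<lambda>z. \<Sum>m. diffs c m * z ^ m) has_real_derivative (\<Sum>m. diffs (diffs c) m * z ^ m)) (at z)" for z
    by (rule termdiffs_strong_converges_everywhere)
  then show "continuous_on UNIV (\<lambda>z. \<Sum>m. diffs c m * z ^ m)"
    by (meson DERIV_isCont continuous_at_imp_continuous_on)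
qed

text \<open>Cancels one of the two factorials in the coefficients of the second Bessel series, which
  leaves the bound \<open>1 / fact m\<close>.\<close>

lemma harm_le_fact: "harm m \<le> (fact m :: real)"
proof -
  have "harm m \<le> real m"
  proof (induction m)
    case (Suc m)
    have "harm (Suc m) = harm m + inverse (real (Suc m))" by (simp add: harm_Suc)
    moreover have "inverse (real (Suc m)) \<le> 1" by (simp add: field_simps)
    ultimately show ?case using Suc by simp
  qed (simp add: harm_def)
  also have "real m \<le> fact m"
    by (metis fact_ge_self of_nat_fact of_nat_le_iff)
  finally show ?thesis .
qed

text \<open>J0 and the non-logarithmic part of Y0 are entire series in the variable
  \<open>(x / 2)\<^sup>2\<close>. The logarithm is what restricts the claim to positive
  arguments.\<close>

lemma hankel1_0_C1:
  obtains H' where "\<And>r. 0 < r \<Longrightarrow> (hankel1_0 has_vector_derivative H' r) (at r)"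
    and "continuous_on {0<..} H'"
proof -
  define a b :: "nat \<Rightarrow> real" where "a m = (-1) ^ m / (fact m)\<^sup>2"
    and "b m = (-1) ^ m * harm m / (fact m)\<^sup>2" for m
  have "(1::real) \<le> fact m" for m by (rule fact_ge_1)
  then have "\<bar>a m\<bar> \<le> 1 / fact m" for m
    by (simp add: a_def abs_divide power_abs power2_eq_square field_simps)
  then obtain A' where A': "\<And>z. ((\<lambda>z. \<Sum>m. a m * z ^ m) has_real_derivative A' z) (at z)"
    "continuous_on UNIV A'" by (rule entire_series_C1) blast
  have "\<bar>b m\<bar> \<le> 1 / fact m" for m
    using harm_le_fact[of m] harm_nonneg[of m, where 'a=real]
    by (simp add: b_def abs_divide abs_mult power_abs power2_eq_square field_simps)
  then obtain B' where B': "\<And>z. ((\<lambda>z. \<Sum>m. b m * z ^ m) has_real_derivative B' z) (at z)"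
    "continuous_on UNIV B'" by (rule entire_series_C1) blast
  define A B where "A z = (\<Sum>m. a m * z ^ m)" and "B z = (\<Sum>m. b m * z ^ m)" for z
  have A: "(A has_real_derivative A' z) (at z)" and B: "(B has_real_derivative B' z) (at z)" for z
    using A'(1) B'(1) by (simp_all add: A_def[abs_def] B_def[abs_def])
  have J: "bessel_J0 = (\<lambda>x. A ((x / 2)\<^sup>2))"
    by (simp add: fun_eq_iff bessel_J0_def A_def a_def power_mult)
  have Y: "bessel_Y0 = (\<lambda>x. 2 / pi * (ln (x / 2) + euler_mascheroni) * A ((x / 2)\<^sup>2) - 2 / pi * B ((x / 2)\<^sup>2))"
    by (simp add: fun_eq_iff bessel_Y0_def J B_def b_def power_mult)
  define J' Y' where "J' x = A' ((x / 2)\<^sup>2) * (x / 2)"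
    and "Y' x = 2 / pi * (1 / x * A ((x / 2)\<^sup>2) + (ln (x / 2) + euler_mascheroni) * (A' ((x / 2)\<^sup>2) * (x / 2)))
      - 2 / pi * (B' ((x / 2)\<^sup>2) * (x / 2))" for x
  have sq: "((\<lambda>x. (x / 2)\<^sup>2) has_real_derivative x / 2) (at x)" for x :: real
    by (auto intro!: derivative_eq_intros)
  have Asq: "((\<lambda>x. A ((x / 2)\<^sup>2)) has_real_derivative A' ((x / 2)\<^sup>2) * (x / 2)) (at x)"
    and Bsq: "((\<lambda>x. B ((x / 2)\<^sup>2)) has_real_derivative B' ((x / 2)\<^sup>2) * (x / 2)) (at x)" for x
    by (rule DERIV_chain2[OF A sq], rule DERIV_chain2[OF B sq])
  have J': "(bessel_J0 has_real_derivative J' x) (at x)" for x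
    unfolding J J'_def by (rule Asq)
  have Y': "(bessel_Y0 has_real_derivative Y' x) (at x)" if "0 < x" for x
  proof -
    have "((\<lambda>x. ln (x / 2) + euler_mascheroni) has_real_derivative 1 / x) (at x)"
      using that by (auto intro!: derivative_eq_intros simp: field_simps)
    from DERIV_mult[OF this Asq]
    have "((\<lambda>x. (ln (x / 2) + euler_mascheroni) * A ((x / 2)\<^sup>2)) has_real_derivative
      1 / x * A ((x / 2)\<^sup>2) + (ln (x / 2) + euler_mascheroni) * (A' ((x / 2)\<^sup>2) * (x / 2))) (at x)"
      by (simp only: add.commute mult.commute)
    from DERIV_diff[OF DERIV_cmult[OF this, of "2 / pi"] DERIV_cmult[OF Bsq, of "2 / pi"]]
    show ?thesis unfolding Y Y'_def by (simp only: mult.assoc)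
  qed
  have eq: "hankel1_0 = (\<lambda>x. of_real (bessel_J0 x) + \<i> * of_real (bessel_Y0 x))"
    by (simp add: fun_eq_iff hankel1_0_def complex_eq_iff)
  show ?thesis
  proof (rule that[of "\<lambda>r. of_real (J' r) + \<i> * of_real (Y' r)"])
    fix r :: real assume "0 < r"
    show "(hankel1_0 has_vector_derivative (of_real (J' r) + \<i> * of_real (Y' r))) (at r)"
      unfolding eq
      by (intro has_vector_derivative_add has_vector_derivative_mult_right has_vector_derivative_of_real
          J'
          Y'[OF \<open>0 < r\<close>])
  next
    have A0: "continuous_on UNIV A"
      using A by (meson DERIV_isCont continuous_at_imp_continuous_on)
    have "continuous_on {0<..} J'"
      unfolding J'_def
      by (intro continuous_intros continuous_on_compose2[OF A'(2)]) auto
    moreover have "continuous_on {0<..} Y'"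
      unfolding Y'_def
      by (intro continuous_intros continuous_on_compose2[OF A'(2)] continuous_on_compose2[OF B'(2)]
          continuous_on_compose2[OF A0]) auto
    ultimately show "continuous_on {0<..} (\<lambda>r. of_real (J' r) + \<i> * of_real (Y' r) :: complex)"
      by (intro continuous_intros)
  qed
qed

text \<open>By the chain rule the kernel is an explicit expression in the normal, the derivative of
  the Hankel function and the distance from \<open>x\<close> to \<open>y\<close>. It can be singular
  only at \<open>x = y\<close>, so continuity up to the boundary is bought by keeping the
  observation set away from the antenna.\<close>

lemma continuous_on_normal_deriv_Phi:
  assumes "0 < k" "C2_boundary D" "T \<inter> frontier D = {}"
  shows "continuous_on (T \<times> frontier D) (\<lambda>(x, y). normal_deriv_Phi k D x y)"
proof -
  obtain H' where H': "\<And>r. 0 < r \<Longrightarrow> (hankel1_0 has_vector_derivative H' r) (at r)"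
    "continuous_on {0<..} H'" by (rule hankel1_0_C1) blast
  have eq: "normal_deriv_Phi k D x y = \<i> / 4 * (of_real (k * ((y - x) \<bullet> outward_normal D y / norm (y - x))) * H' (k * norm (x - y)))"
    if "x \<noteq> y" for x y
  proof -
    define v where "v = outward_normal D y"
    have "((\<lambda>t::real. norm (y - x + t *\<^sub>R v)) has_derivative (\<lambda>t. (t *\<^sub>R v) \<bullet> sgn (y - x))) (at 0)"
    proof (rule has_derivative_compose[where f = "\<lambda>t. y - x + t *\<^sub>R v" and g = norm])
      show "((\<lambda>t. y - x + t *\<^sub>R v) has_derivative (\<lambda>t. t *\<^sub>R v)) (at 0)"
        by (auto intro!: derivative_eq_intros)
      show "(norm has_derivative (\<lambda>u. u \<bullet> sgn (y - x))) (at (y - x + 0 *\<^sub>R v))"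
        using that by (simp add: has_derivative_norm)
    qed
    then have "((\<lambda>t::real. norm (y - x + t *\<^sub>R v)) has_real_derivative v \<bullet> sgn (y - x)) (at 0)"
      by (simp add: has_field_derivative_def mult.commute[of _ "v \<bullet> sgn (y - x)"])
    then have "((\<lambda>t::real. k * norm (y - x + t *\<^sub>R v)) has_real_derivative k * (v \<bullet> sgn (y - x))) (at 0)"
      by (rule DERIV_cmult)
    moreover have "norm (y - x + t *\<^sub>R v) = norm (x - (y + t *\<^sub>R v))" for t
      by (metis add_diff_eq diff_diff_eq2 norm_minus_commute add.commute diff_add_eq)
    moreover have "v \<bullet> sgn (y - x) = (y - x) \<bullet> v / norm (y - x)"
      by (simp add: sgn_div_norm inner_commute divide_inverse mult.commute)
    ultimately have 1: "((\<lambda>t::real. k * norm (x - (y + t *\<^sub>R v))) has_vector_derivative k * ((y - x) \<bullet> v / norm (y - x))) (at 0)"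
      by (simp add: has_real_derivative_iff_has_vector_derivative)
    have 2: "(hankel1_0 has_vector_derivative H' (k * norm (x - y))) (at (k * norm (x - (y + 0 *\<^sub>R v))))"
      using H'(1)[of "k * norm (x - y)"] assms(1) that by simp
    have "((\<lambda>t. helmholtz_Phi k x (y + t *\<^sub>R v)) has_vector_derivative
      \<i> / 4 * (of_real (k * ((y - x) \<bullet> v / norm (y - x))) * H' (k * norm (x - y)))) (at 0)"
      unfolding helmholtz_Phi_def
      using vector_diff_chain_at[OF 1 2]
      by (intro has_vector_derivative_mult_right) (simp add: o_def scaleR_conv_of_real)
    then show ?thesis
      unfolding normal_deriv_Phi_def v_def by (rule vector_derivative_at)
  qed
  have ne: "fst p \<noteq> snd p" if "p \<in> T \<times> frontier D" for p
    using that assms(3) by auto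
  have "continuous_on (T \<times> frontier D) (\<lambda>p. \<i> / 4 * (of_real (k * ((snd p - fst p) \<bullet> outward_normal D (snd p) / norm (snd p - fst p))) * H' (k * norm (fst p - snd p))))"
    using ne assms(1)
    by (intro continuous_intros continuous_on_compose2[OF H'(2)]
        continuous_on_compose2[OF continuous_on_outward_normal[OF assms(2)]]) (fastforce simp: less_le)+
  then show ?thesis
    by (rule continuous_on_eq) (use ne eq in \<open>simp add: case_prod_unfold\<close>)
qed

subsection \<open>Integral operators with continuous kernels\<close>

text \<open>\<open>double_layer\<close> with measure and kernel as parameters, so that the adjoint
  is an operator of the same kind.\<close>

definition kernel_op :: "plane measure \<Rightarrow> (plane \<Rightarrow> plane \<Rightarrow> complex) \<Rightarrow> field \<Rightarrow> field" where
  "kernel_op A \<kappa> \<phi> x = (LINT y|A. \<phi> y * \<kappa> x y)"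

lemma kernel_op_cong: "(\<And>x. x \<in> space M \<Longrightarrow> f x = g x) \<Longrightarrow> kernel_op M \<kappa> f = kernel_op M \<kappa> g"
  unfolding kernel_op_def by (intro ext Bochner_Integration.integral_cong) auto

definition adj_kernel :: "(plane \<Rightarrow> plane \<Rightarrow> complex) \<Rightarrow> plane \<Rightarrow> plane \<Rightarrow> complex" where
  "adj_kernel \<kappa> y x = cnj (\<kappa> x y)"

section \<open>Second kind equations on a compact boundary\<close>

locale compact_measure = finite_measure A for A :: "plane measure" +
  fixes S :: "plane set"
  assumes sets_A: "sets A = sets (restrict_space borel S)"
    and compact_S: "compact S"
begin

lemma space_A: "space A = S"
  using sets_eq_imp_space_eq[OF sets_A] by (simp add: space_restrict_space)

lemma measurable_continuous:
  fixes f :: "plane \<Rightarrow> 'b::topological_space"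
  shows "continuous_on S f \<Longrightarrow> f \<in> borel_measurable A"
  using borel_measurable_continuous_on_restrict measurable_cong_sets[OF sets_A refl] by blast

lemma l2_continuous:
  assumes "continuous_on S f"
  shows "f \<in> l2 A"
proof -
  have "bounded (f ` S)"
    using assms compact_S by (intro compact_imp_bounded compact_continuous_image)
  then obtain c where "\<And>x. x \<in> S \<Longrightarrow> cmod (f x) \<le> c" by (auto simp: bounded_iff)
  then show ?thesis
    using measurable_continuous[OF assms] by (intro l2_bounded) (auto simp: space_A finite_measure_axioms)
qed

lemma l2_norm_le_sup:
  assumes "continuous_on S f" "\<And>x. x \<in> S \<Longrightarrow> cmod (f x) \<le> c" "0 \<le> c"
  shows "l2_norm A f \<le> c * sqrt (measure A S)"
  using l2_norm_bounded[OF finite_measure_axioms measurable_continuous[OF assms(1)], of c] assms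
  by (simp add: space_A)

text \<open>The Richardson iteration \<open>e \<mapsto> q e - \<tau> P e\<close> contracts the \<open>L\<^sup>2\<close> norm by the factor \<open>q\<close>.
  As \<open>P\<close> maps \<open>L\<^sup>2\<close> boundedly into the continuous functions, the iterates decay geometrically
  also in the supremum norm, so their sum is a continuous function; completeness of \<open>L\<^sup>2\<close> is
  not needed.\<close>

lemma second_kind_equation_solvable:
  assumes lin: "\<And>u v a b y. u \<in> l2 A \<Longrightarrow> v \<in> l2 A \<Longrightarrow> y \<in> S \<Longrightarrow>
      P (\<lambda>x. a * u x + b * v x) y = a * P u y + b * P v y"
    and cont: "\<And>u. u \<in> l2 A \<Longrightarrow> continuous_on S (P u)"
    and bdd: "\<And>u y. u \<in> l2 A \<Longrightarrow> y \<in> S \<Longrightarrow> cmod (P u y) \<le> c * l2_norm A u"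
    and pos: "\<And>u. u \<in> l2 A \<Longrightarrow> (l2_norm A (P u))\<^sup>2 \<le> d * Re (l2_inner A (P u) u)"
    and c: "0 \<le> c" and d: "0 < d" and \<alpha>: "0 < \<alpha>" and g: "continuous_on S g"
  obtains \<phi> where "continuous_on S \<phi>" "\<And>y. y \<in> S \<Longrightarrow> of_real \<alpha> * \<phi> y + P \<phi> y = g y"
proof -
  \<comment> \<open>\<open>1 - q = \<tau> * \<alpha>\<close> turns the equation, multiplied by
    \<open>\<tau>\<close>, into the fixed-point equation
    \<open>\<phi> = T \<phi> + \<tau> g\<close>. \<open>\<tau> * d = q\<close> lets
    \<open>pos\<close> bound the term quadratic in \<open>P u\<close> by half of the negative cross
    term.\<close>
  define \<tau> q where "\<tau> = 1 / (\<alpha> + d)" and "q = d / (\<alpha> + d)"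
  have \<tau>: "0 < \<tau>" "1 - q = \<tau> * \<alpha>" "\<tau> * d = q" and q: "0 < q" "q < 1"
    using d \<alpha> by (auto simp: \<tau>_def q_def field_simps)
  define T where "T u y = of_real q * u y - of_real \<tau> * P u y" for u y
  have T_cont: "continuous_on S (T u)" if "continuous_on S u" for u
    unfolding T_def[abs_def] using that cont[OF l2_continuous[OF that]] by (intro continuous_intros)
  have T_contr: "l2_norm A (T u) \<le> q * l2_norm A u" if "continuous_on S u" for u
  proof (rule power2_le_imp_le)
    have u: "u \<in> l2 A" and Pu: "P u \<in> l2 A"
      using that cont l2_continuous by blast+
    define N I where "N = l2_norm A (P u)" and "I = Re (l2_inner A (P u) u)"
    have *: "T u = (\<lambda>y. of_real q * u y + (- of_real \<tau>) * P u y)"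
      by (simp add: T_def fun_eq_iff)
    have Tu: "T u \<in> l2 A" unfolding * using u Pu by (rule l2_linear_combination)
    have "of_real ((l2_norm A (T u))\<^sup>2) = of_real q * l2_inner A u (T u) - of_real \<tau> * l2_inner A (P u) (T u)"
      unfolding l2_inner_self[symmetric]
      by (subst (1) *, subst l2_inner_linear_left[OF u Pu Tu]) simp
    also have "l2_inner A u (T u) = of_real q * of_real ((l2_norm A u)\<^sup>2) - of_real \<tau> * cnj (l2_inner A (P u) u)"
      unfolding l2_inner_commute[of A u "T u"]
      by (subst *, subst l2_inner_linear_left[OF u Pu u]) (simp add: l2_inner_self)
    also have "l2_inner A (P u) (T u) = of_real q * l2_inner A (P u) u - of_real \<tau> * of_real (N\<^sup>2)"
      unfolding l2_inner_commute[of A "P u" "T u"]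
      by (subst *, subst l2_inner_linear_left[OF u Pu Pu])
        (simp add: l2_inner_self N_def l2_inner_commute[of A u "P u"])
    finally have "(l2_norm A (T u))\<^sup>2 = Re (of_real q * (of_real q * of_real ((l2_norm A u)\<^sup>2) - of_real \<tau> * cnj (l2_inner A (P u) u))
        - of_real \<tau> * (of_real q * l2_inner A (P u) u - of_real \<tau> * of_real (N\<^sup>2)))"
      by (metis Re_complex_of_real)
    also have "\<dots> = q\<^sup>2 * (l2_norm A u)\<^sup>2 - 2 * \<tau> * q * I + \<tau>\<^sup>2 * N\<^sup>2"
      by (simp add: I_def power2_eq_square algebra_simps)
    also have "\<dots> \<le> q\<^sup>2 * (l2_norm A u)\<^sup>2 - \<tau> * q * I"
    proof -
      have "\<tau>\<^sup>2 * N\<^sup>2 \<le> \<tau>\<^sup>2 * (d * I)"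
        unfolding N_def I_def using pos[OF u] by (intro mult_left_mono) auto
      also have "\<dots> = \<tau> * q * I" using \<tau>(3) by (simp add: power2_eq_square algebra_simps)
      finally show ?thesis by (simp add: mult_ac)
    qed
    also have "\<dots> \<le> (q * l2_norm A u)\<^sup>2"
    proof -
      have "0 \<le> d * I" using pos[OF u] zero_le_power2[of N] unfolding N_def I_def by linarith
      then have "0 \<le> I" using d by (simp add: zero_le_mult_iff)
      then show ?thesis using \<tau> q by (simp add: power_mult_distrib)
    qed
    finally show "(l2_norm A (T u))\<^sup>2 \<le> (q * l2_norm A u)\<^sup>2" .
  qed (use q l2_norm_nonneg in simp)
  \<comment> \<open>Terms of the Neumann series for the inverse of the identity minus
    \<open>T\<close>, applied to \<open>\<tau> g\<close>.\<close>
  define e where "e n = (T ^^ n) (\<lambda>y. of_real \<tau> * g y)" for n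
  have e0: "e 0 = (\<lambda>y. of_real \<tau> * g y)" and eSuc: "e (Suc n) = T (e n)" for n
    by (simp_all add: e_def)
  have e_cont: "continuous_on S (e n)" for n
    by (induction n) (use g T_cont in \<open>auto simp: e0 eSuc intro!: continuous_intros\<close>)
  have e_l2: "e n \<in> l2 A" for n by (rule l2_continuous[OF e_cont])
  define E where "E = l2_norm A (e 0)"
  have E: "0 \<le> E" by (simp add: E_def l2_norm_nonneg)
  have e_norm: "l2_norm A (e n) \<le> q ^ n * E" for n
  proof (induction n)
    case (Suc n)
    have "l2_norm A (e (Suc n)) \<le> q * l2_norm A (e n)" unfolding eSuc by (rule T_contr[OF e_cont])
    also have "\<dots> \<le> q * (q ^ n * E)" using Suc q by (intro mult_left_mono) auto
    finally show ?case by simp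
  qed (simp add: E_def)
  have "bounded (e 0 ` S)"
    using e_cont compact_S by (intro compact_imp_bounded compact_continuous_image)
  then obtain G where G: "0 < G" "\<And>x. x \<in> S \<Longrightarrow> cmod (e 0 x) \<le> G" by (auto simp: bounded_pos)
  \<comment> \<open>In the supremum norm each step multiplies by \<open>q\<close> and adds at most
    \<open>\<tau> * c * E * q ^ n\<close>. This forcing is resonant with \<open>q\<close>, so decay
    is claimed at a slower rate \<open>r\<close> strictly between \<open>q\<close> and 1;
    \<open>D\<close> is made large enough that \<open>\<tau> * c * E \<le> D * (r - q)\<close>
    closes the induction.\<close>
  define r where "r = (1 + q) / 2"
  have r: "q < r" "0 < r" "r < 1" using q by (auto simp: r_def)
  define D where "D = G + \<tau> * c * E / (r - q)"
  have "0 \<le> \<tau> * c * E / (r - q)" using \<tau> c E r by simp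
  then have D: "G \<le> D" "0 \<le> D" using G by (auto simp: D_def)
  have D2: "\<tau> * c * E \<le> D * (r - q)"
  proof -
    have "\<tau> * c * E = \<tau> * c * E / (r - q) * (r - q)" using r by simp
    also have "\<dots> \<le> D * (r - q)" using r G by (intro mult_right_mono) (auto simp: D_def)
    finally show ?thesis .
  qed
  have e_sup: "cmod (e n y) \<le> D * r ^ n" if y: "y \<in> S" for n y
  proof (induction n)
    case 0
    then show ?case using G(2)[OF y] D by simp
  next
    case (Suc n)
    have "cmod (e (Suc n) y) \<le> q * cmod (e n y) + \<tau> * cmod (P (e n) y)"
      unfolding eSuc T_def using norm_triangle_ineq4[of "of_real q * e n y" "of_real \<tau> * P (e n) y"] q \<tau>
      by (simp add: norm_mult)
    also have "\<dots> \<le> q * (D * r ^ n) + \<tau> * (c * (q ^ n * E))"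
    proof (intro add_mono mult_left_mono Suc)
      show "cmod (P (e n) y) \<le> c * (q ^ n * E)"
        using bdd[OF e_l2 y] mult_left_mono[OF e_norm c] by (rule order_trans)
    qed (use q \<tau> in auto)
    also have "\<tau> * (c * (q ^ n * E)) \<le> D * (r - q) * r ^ n"
    proof -
      have "(\<tau> * c * E) * q ^ n \<le> (D * (r - q)) * r ^ n"
        by (rule mult_mono[OF D2 power_mono]) (use q r D in auto)
      then show ?thesis by (simp add: algebra_simps)
    qed
    finally show ?case by (simp add: algebra_simps)
  qed
  define \<phi> where "\<phi> y = (\<Sum>n. e n y)" for y
  define s where "s n y = (\<Sum>i<n. e i y)" for n y
  have lim: "uniform_limit S s \<phi> sequentially"
    unfolding s_def[abs_def] \<phi>_def[abs_def]
    by (rule Weierstrass_m_test[where M = "\<lambda>n. D * r ^ n"])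
      (use e_sup r in \<open>auto intro!: summable_mult summable_geometric\<close>)
  have s_cont: "\<And>n. continuous_on S (s n)"
    unfolding s_def[abs_def] using e_cont by (intro continuous_intros)
  have \<phi>_cont: "continuous_on S \<phi>"
    by (rule uniform_limit_theorem[OF always_eventually lim]) (use s_cont in auto)
  have s_l2: "s n \<in> l2 A" for n by (rule l2_continuous[OF s_cont])
  have \<phi>_l2: "\<phi> \<in> l2 A" by (rule l2_continuous[OF \<phi>_cont])
  \<comment> \<open>By linearity the partial sums obey the fixed-point iteration
    \<open>s (Suc n) = \<tau> g + T (s n)\<close>; its limit is the equation.\<close>
  have s_Suc: "s (Suc n) y = of_real \<tau> * g y + of_real q * s n y - of_real \<tau> * P (s n) y" if y: "y \<in> S" for n y
  proof (induction n)
    case 0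
    have "P (\<lambda>x. 0) y = 0"
      using lin[OF e_l2 e_l2 y, of 0 0 0 0] by simp
    then show ?case by (simp add: s_def[abs_def] e0)
  next
    case (Suc n)
    have P_Suc: "P (s (Suc n)) y = P (s n) y + P (e n) y"
      using lin[OF s_l2 e_l2 y, of 1 n 1 n] by (simp add: s_def[abs_def])
    have s_Suc: "s (Suc n) y = s n y + e n y" by (simp add: s_def)
    have "s (Suc (Suc n)) y = s (Suc n) y + T (e n) y" by (simp add: s_def eSuc)
    also have "\<dots> = (of_real \<tau> * g y + of_real q * s n y - of_real \<tau> * P (s n) y)
        + (of_real q * e n y - of_real \<tau> * P (e n) y)"
      unfolding Suc T_def ..
    also have "\<dots> = of_real \<tau> * g y + of_real q * (s n y + e n y) - of_real \<tau> * (P (s n) y + P (e n) y)"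
      by (simp add: algebra_simps)
    finally show ?case by (simp only: P_Suc s_Suc)
  qed
  have "of_real \<alpha> * \<phi> y + P \<phi> y = g y" if y: "y \<in> S" for y
  proof -
    have sy: "(\<lambda>n. s n y) \<longlonglongrightarrow> \<phi> y"
      using lim y by (rule tendsto_uniform_limitI)
    have Py: "(\<lambda>n. P (s n) y) \<longlonglongrightarrow> P \<phi> y"
    proof (rule tendstoI)
      fix \<epsilon> :: real assume "0 < \<epsilon>"
      \<comment> \<open>The summand 1 keeps \<open>m\<close> positive when \<open>c\<close> or the
        measure of \<open>S\<close> vanishes, and makes the last inequality strict.\<close>
      define m where "m = c * sqrt (measure A S) + 1"
      have m: "0 < m" using c by (simp add: m_def add_nonneg_pos)
      have "\<forall>\<^sub>F n in sequentially. \<forall>x\<in>S. dist (s n x) (\<phi> x) < \<epsilon> / m"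
        using lim \<open>0 < \<epsilon>\<close> m by (simp add: uniform_limit_iff)
      then show "\<forall>\<^sub>F n in sequentially. dist (P (s n) y) (P \<phi> y) < \<epsilon>"
      proof eventually_elim
        case (elim n)
        have "cmod (P (s n) y - P \<phi> y) = cmod (P (\<lambda>x. s n x - \<phi> x) y)"
          using lin[OF s_l2 \<phi>_l2 y, of 1 n "-1"] by simp
        also have "\<dots> \<le> c * l2_norm A (\<lambda>x. s n x - \<phi> x)"
          using s_l2 \<phi>_l2 y by (intro bdd l2_diff)
        also have "\<dots> \<le> c * (\<epsilon> / m * sqrt (measure A S))"
          using elim c \<open>0 < \<epsilon>\<close> m s_cont \<phi>_cont
          by (intro mult_left_mono l2_norm_le_sup continuous_intros) (auto simp: dist_norm less_imp_le)
        also have "\<dots> = \<epsilon> * ((c * sqrt (measure A S)) / m)" by simp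
        also have "\<dots> < \<epsilon> * 1"
          using \<open>0 < \<epsilon>\<close> m by (intro mult_strict_left_mono) (auto simp: m_def)
        finally show ?case by (simp add: dist_norm)
      qed
    qed
    have "(\<lambda>n. of_real \<tau> * g y + of_real q * s n y - of_real \<tau> * P (s n) y)
        \<longlonglongrightarrow> of_real \<tau> * g y + of_real q * \<phi> y - of_real \<tau> * P \<phi> y"
      using sy Py by (intro tendsto_intros)
    moreover have "(\<lambda>n. of_real \<tau> * g y + of_real q * s n y - of_real \<tau> * P (s n) y) \<longlonglongrightarrow> \<phi> y"
      using LIMSEQ_Suc[OF sy] by (simp add: s_Suc[OF y])
    ultimately have "\<phi> y = of_real \<tau> * g y + of_real q * \<phi> y - of_real \<tau> * P \<phi> y"
      by (rule LIMSEQ_unique[symmetric])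
    then have "of_real (1 - q) * \<phi> y + of_real \<tau> * P \<phi> y = of_real \<tau> * g y"
      by (simp add: algebra_simps)
    then have "of_real \<tau> * (of_real \<alpha> * \<phi> y + P \<phi> y) = of_real \<tau> * g y"
      unfolding \<tau>(2) by (simp add: algebra_simps)
    then show ?thesis using \<tau>(1) by simp
  qed
  with \<phi>_cont show ?thesis by (rule that)
qed

end

section \<open>Continuous kernels between two compact boundaries\<close>

text \<open>\<open>A\<close> on \<open>S\<close> is the source and \<open>B\<close> on
  \<open>T\<close> the target; the kernel takes the target point first.\<close>

locale compact_kernel = A: compact_measure A S + B: compact_measure B T
  for A S B T +
  fixes \<kappa> :: "plane \<Rightarrow> plane \<Rightarrow> complex"
  assumes continuous_kernel: "continuous_on (T \<times> S) (\<lambda>(x, y). \<kappa> x y)"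
begin

text \<open>The locale is closed under passing to the adjoint, so each fact below is available for
  both directions.\<close>

lemma adjoint_kernel: "compact_kernel B T A S (adj_kernel \<kappa>)"
proof (unfold_locales)
  have "continuous_on (S \<times> T) (\<lambda>p. cnj ((\<lambda>(x, y). \<kappa> x y) (snd p, fst p)))"
    by (intro continuous_intros continuous_on_compose2[OF continuous_kernel]) auto
  then show "continuous_on (S \<times> T) (\<lambda>(x, y). adj_kernel \<kappa> x y)"
    by (simp add: adj_kernel_def case_prod_unfold)
qed

lemma kernel_bounded:
  obtains b where "0 \<le> b" "\<And>x y. x \<in> T \<Longrightarrow> y \<in> S \<Longrightarrow> cmod (\<kappa> x y) \<le> b"
proof -
  have "bounded ((\<lambda>(x, y). \<kappa> x y) ` (T \<times> S))"
    using A.compact_S B.compact_S continuous_kernel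
    by (intro compact_imp_bounded compact_continuous_image compact_Times)
  then obtain b where "0 < b" "\<forall>z \<in> (\<lambda>(x, y). \<kappa> x y) ` (T \<times> S). cmod z \<le> b"
    unfolding bounded_pos by blast
  then show ?thesis by (intro that[of b]) auto
qed

lemma measurable_kernel: "x \<in> T \<Longrightarrow> \<kappa> x \<in> borel_measurable A"
  by (rule A.measurable_continuous, rule continuous_on_compose2[OF continuous_kernel, of S "\<lambda>y. (x, y)", simplified])
    (auto intro!: continuous_intros)

text \<open>Continuity is known only on the compact product, so the kernel is cut off there to
  become a Borel function on all pairs, and then composed with the inclusion of \<open>A\<close> and
  \<open>B\<close> into the plane.\<close>

lemma measurable_kernel_pair: "(\<lambda>(y, x). \<kappa> x y) \<in> borel_measurable (A \<Otimes>\<^sub>M B)"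
proof -
  have "closed (T \<times> S)"
    using A.compact_S B.compact_S by (intro closed_Times compact_imp_closed)
  then have 1: "(\<lambda>p. indicator (T \<times> S) p *\<^sub>R (\<lambda>(x, y). \<kappa> x y) p) \<in> borel_measurable borel"
    using continuous_kernel by (intro borel_measurable_continuous_on_indicator) auto
  have "(\<lambda>y. y) \<in> A \<rightarrow>\<^sub>M borel" "(\<lambda>y. y) \<in> B \<rightarrow>\<^sub>M borel"
    by (auto intro!: A.measurable_continuous B.measurable_continuous continuous_intros)
  then have 2: "(\<lambda>p. (snd p, fst p)) \<in> A \<Otimes>\<^sub>M B \<rightarrow>\<^sub>M borel"
    unfolding borel_prod[symmetric] by measurable
  from measurable_compose[OF 2 1]
  have "(\<lambda>p. indicator (T \<times> S) (snd p, fst p) *\<^sub>R \<kappa> (snd p) (fst p)) \<in> borel_measurable (A \<Otimes>\<^sub>M B)"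
    by simp
  then show ?thesis
    by (rule measurable_cong[THEN iffD1, rotated]) (auto simp: space_pair_measure A.space_A B.space_A)
qed

lemma integrable_kernel:
  assumes "\<phi> \<in> l2 A" "x \<in> T"
  shows "integrable A (\<lambda>y. \<phi> y * \<kappa> x y)"
proof -
  obtain b where b: "0 \<le> b" "\<And>x y. x \<in> T \<Longrightarrow> y \<in> S \<Longrightarrow> cmod (\<kappa> x y) \<le> b"
    using kernel_bounded by blast
  show ?thesis
  proof (rule Bochner_Integration.integrable_bound)
    show "integrable A (\<lambda>y. of_real b * \<phi> y)"
      using l2_integrable[OF A.finite_measure_axioms assms(1)] by simp
    show "(\<lambda>y. \<phi> y * \<kappa> x y) \<in> borel_measurable A"
      using l2_measurable[OF assms(1)] measurable_kernel[OF assms(2)] by measurable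
    show "AE y in A. cmod (\<phi> y * \<kappa> x y) \<le> cmod (of_real b * \<phi> y)"
      using b assms(2) by (intro AE_I2) (simp add: A.space_A norm_mult mult.commute[of b] mult_left_mono)
  qed
qed

lemma kernel_op_linear:
  assumes "u \<in> l2 A" "v \<in> l2 A" "x \<in> T"
  shows "kernel_op A \<kappa> (\<lambda>y. a * u y + b * v y) x = a * kernel_op A \<kappa> u x + b * kernel_op A \<kappa> v x"
proof -
  have "kernel_op A \<kappa> (\<lambda>y. a * u y + b * v y) x = (LINT y|A. a * (u y * \<kappa> x y) + b * (v y * \<kappa> x y))"
    unfolding kernel_op_def by (rule Bochner_Integration.integral_cong) (auto simp: algebra_simps)
  then show ?thesis
    using assms by (simp add: kernel_op_def integrable_kernel)
qed

text \<open>Cauchy-Schwarz against a slice of the kernel. The bound is pointwise, not just in L2;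
  the supremum estimates of the Neumann series rest on it.\<close>

lemma kernel_op_bounded:
  obtains c where "0 \<le> c" "\<And>\<phi> x. \<phi> \<in> l2 A \<Longrightarrow> x \<in> T \<Longrightarrow> cmod (kernel_op A \<kappa> \<phi> x) \<le> c * l2_norm A \<phi>"
proof -
  obtain b where b: "0 \<le> b" "\<And>x y. x \<in> T \<Longrightarrow> y \<in> S \<Longrightarrow> cmod (\<kappa> x y) \<le> b"
    using kernel_bounded by blast
  have "cmod (kernel_op A \<kappa> \<phi> x) \<le> b * sqrt (measure A S) * l2_norm A \<phi>" if \<phi>: "\<phi> \<in> l2 A" and x: "x \<in> T" for \<phi> x
  proof -
    have \<kappa>_l2: "(\<lambda>y. cnj (\<kappa> x y)) \<in> l2 A"
      by (rule A.l2_continuous, intro continuous_intros,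
          rule continuous_on_compose2[OF continuous_kernel, of S "\<lambda>y. (x, y)", simplified])
        (use x in \<open>auto intro!: continuous_intros\<close>)
    have "kernel_op A \<kappa> \<phi> x = l2_inner A \<phi> (\<lambda>y. cnj (\<kappa> x y))"
      by (simp add: kernel_op_def l2_inner_def)
    also have "cmod \<dots> \<le> l2_norm A \<phi> * l2_norm A (\<lambda>y. cnj (\<kappa> x y))"
      by (rule l2_cauchy_schwarz[OF \<phi> \<kappa>_l2])
    also have "\<dots> \<le> l2_norm A \<phi> * (b * sqrt (measure A (space A)))"
      using b x \<kappa>_l2
      by (intro mult_left_mono l2_norm_bounded A.finite_measure_axioms l2_norm_nonneg l2_measurable)
        (auto simp: A.space_A)
    finally show ?thesis by (simp add: A.space_A mult.commute)
  qed
  then show ?thesis by (intro that[of "b * sqrt (measure A S)"]) (use b in auto)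
qed

text \<open>Dominated convergence along sequences: a multiple of \<open>cmod (\<phi> y)\<close>
  dominates, and it is integrable because the measure is finite.\<close>

lemma continuous_on_kernel_op:
  assumes \<phi>: "\<phi> \<in> l2 A"
  shows "continuous_on T (kernel_op A \<kappa> \<phi>)"
  unfolding continuous_on_sequentially
proof (intro ballI allI impI, elim conjE)
  obtain b where b: "0 \<le> b" "\<And>x y. x \<in> T \<Longrightarrow> y \<in> S \<Longrightarrow> cmod (\<kappa> x y) \<le> b"
    using kernel_bounded by blast
  fix x :: "nat \<Rightarrow> plane" and a assume a: "a \<in> T" and x: "\<forall>n. x n \<in> T" and lim: "x \<longlonglongrightarrow> a"
  have "(\<lambda>n. LINT y|A. \<phi> y * \<kappa> (x n) y) \<longlonglongrightarrow> (LINT y|A. \<phi> y * \<kappa> a y)"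
  proof (rule integral_dominated_convergence)
    show "(\<lambda>y. \<phi> y * \<kappa> a y) \<in> borel_measurable A" "(\<lambda>y. \<phi> y * \<kappa> (x n) y) \<in> borel_measurable A" for n
      using integrable_kernel[OF \<phi>] a x by (blast intro: borel_measurable_integrable)+
    show "integrable A (\<lambda>y. b * cmod (\<phi> y))"
      using l2_integrable[OF A.finite_measure_axioms \<phi>] by simp
    have "(\<lambda>n. \<kappa> (x n) y) \<longlonglongrightarrow> \<kappa> a y" if "y \<in> S" for y
    proof -
      have "(\<lambda>n. (\<lambda>(x, y). \<kappa> x y) (x n, y)) \<longlonglongrightarrow> (\<lambda>(x, y). \<kappa> x y) (a, y)"
        by (rule continuous_on_tendsto_compose[OF continuous_kernel])
          (use a x lim that in \<open>auto intro!: tendsto_intros\<close>)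
      then show ?thesis by simp
    qed
    then show "AE y in A. (\<lambda>n. \<phi> y * \<kappa> (x n) y) \<longlonglongrightarrow> \<phi> y * \<kappa> a y"
      by (intro AE_I2) (auto simp: A.space_A intro!: tendsto_intros)
    show "AE y in A. cmod (\<phi> y * \<kappa> (x n) y) \<le> b * cmod (\<phi> y)" for n
      using b x by (intro AE_I2) (simp add: A.space_A norm_mult mult.commute[of b] mult_left_mono)
  qed
  then show "(kernel_op A \<kappa> \<phi> \<circ> x) \<longlonglongrightarrow> kernel_op A \<kappa> \<phi> a"
    by (simp add: kernel_op_def o_def)
qed

lemma kernel_op_l2: "\<phi> \<in> l2 A \<Longrightarrow> kernel_op A \<kappa> \<phi> \<in> l2 B"
  by (intro B.l2_continuous continuous_on_kernel_op)

lemma kernel_op_l2_bounded: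
  obtains c where "0 \<le> c" "\<And>\<phi>. \<phi> \<in> l2 A \<Longrightarrow> l2_norm B (kernel_op A \<kappa> \<phi>) \<le> c * l2_norm A \<phi>"
proof -
  obtain c where c: "0 \<le> c" "\<And>\<phi> x. \<phi> \<in> l2 A \<Longrightarrow> x \<in> T \<Longrightarrow> cmod (kernel_op A \<kappa> \<phi> x) \<le> c * l2_norm A \<phi>"
    using kernel_op_bounded by blast
  have "l2_norm B (kernel_op A \<kappa> \<phi>) \<le> (c * sqrt (measure B T)) * l2_norm A \<phi>" if \<phi>: "\<phi> \<in> l2 A" for \<phi>
    using B.l2_norm_le_sup[OF continuous_on_kernel_op[OF \<phi>] c(2)[OF \<phi>]] c(1)
    by (simp add: l2_norm_nonneg algebra_simps)
  then show ?thesis by (intro that[of "c * sqrt (measure B T)"]) (use c in auto)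
qed

text \<open>Fubini. The kernel is bounded and both functions are integrable over finite measures, so
  a multiple of their product dominates the integrand on the product space.\<close>

lemma kernel_op_adjoint:
  assumes \<phi>: "\<phi> \<in> l2 A" and \<psi>: "\<psi> \<in> l2 B"
  shows "l2_inner B (kernel_op A \<kappa> \<phi>) \<psi> = l2_inner A \<phi> (kernel_op B (adj_kernel \<kappa>) \<psi>)"
proof -
  interpret pair_sigma_finite A B ..
  obtain b where b: "0 \<le> b" "\<And>x y. x \<in> T \<Longrightarrow> y \<in> S \<Longrightarrow> cmod (\<kappa> x y) \<le> b"
    using kernel_bounded by blast
  note [measurable] = l2_measurable[OF \<phi>] l2_measurable[OF \<psi>]
  have cnj: "cnj \<in> borel_measurable borel"
    by (intro borel_measurable_continuous_onI continuous_intros)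
  have cnj_\<psi>: "(\<lambda>x. cnj (\<psi> x)) \<in> borel_measurable B"
    using measurable_compose[OF l2_measurable[OF \<psi>] cnj] .
  note [measurable] = measurable_kernel_pair cnj_\<psi>
  have int_\<phi>: "integrable A \<phi>" and int_\<psi>: "integrable B \<psi>"
    using l2_integrable A.finite_measure_axioms B.finite_measure_axioms \<phi> \<psi> by blast+
  have "integrable (A \<Otimes>\<^sub>M B) (\<lambda>p. \<phi> (fst p) * \<psi> (snd p))"
    by (rule Fubini_integrable) (use int_\<phi> int_\<psi> in \<open>auto simp: norm_mult\<close>)
  then have "integrable (A \<Otimes>\<^sub>M B) (\<lambda>p. of_real b * (\<phi> (fst p) * \<psi> (snd p)))"
    by simp
  then have int: "integrable (A \<Otimes>\<^sub>M B) (\<lambda>(y, x). \<phi> y * \<kappa> x y * cnj (\<psi> x))"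
  proof (rule Bochner_Integration.integrable_bound)
    have "(\<lambda>p. \<phi> (fst p) * (\<lambda>(y, x). \<kappa> x y) p * cnj (\<psi> (snd p))) \<in> borel_measurable (A \<Otimes>\<^sub>M B)"
      by measurable
    then show "(\<lambda>(y, x). \<phi> y * \<kappa> x y * cnj (\<psi> x)) \<in> borel_measurable (A \<Otimes>\<^sub>M B)"
      by (simp add: case_prod_unfold)
    have "cmod (\<phi> y * \<kappa> x y * cnj (\<psi> x)) \<le> cmod (of_real b * (\<phi> y * \<psi> x))" if "y \<in> S" "x \<in> T" for x y
    proof -
      have "cmod (\<kappa> x y) * (cmod (\<phi> y) * cmod (\<psi> x)) \<le> b * (cmod (\<phi> y) * cmod (\<psi> x))"
        using b(2)[OF that(2,1)] by (intro mult_right_mono) auto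
      then show ?thesis using b(1) by (simp add: norm_mult mult_ac)
    qed
    then show "AE p in A \<Otimes>\<^sub>M B. cmod ((\<lambda>(y, x). \<phi> y * \<kappa> x y * cnj (\<psi> x)) p) \<le> cmod (of_real b * (\<phi> (fst p) * \<psi> (snd p)))"
      by (intro AE_I2) (auto simp: space_pair_measure A.space_A B.space_A)
  qed
  have "l2_inner B (kernel_op A \<kappa> \<phi>) \<psi> = (LINT x|B. LINT y|A. \<phi> y * \<kappa> x y * cnj (\<psi> x))"
    unfolding l2_inner_def kernel_op_def
    by (rule Bochner_Integration.integral_cong) (auto simp: B.space_A integrable_kernel \<phi>)
  also have "\<dots> = (LINT y|A. LINT x|B. \<phi> y * \<kappa> x y * cnj (\<psi> x))"
    by (rule Fubini_integral[OF int])
  also have "\<dots> = l2_inner A \<phi> (kernel_op B (adj_kernel \<kappa>) \<psi>)"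
  proof -
    have "(LINT x|B. \<phi> y * \<kappa> x y * cnj (\<psi> x)) = \<phi> y * cnj (kernel_op B (adj_kernel \<kappa>) \<psi> y)" for y
    proof -
      have "(LINT x|B. \<phi> y * \<kappa> x y * cnj (\<psi> x)) = (LINT x|B. \<phi> y * cnj (\<psi> x * adj_kernel \<kappa> y x))"
        by (simp add: adj_kernel_def mult_ac)
      also have "\<dots> = \<phi> y * cnj (kernel_op B (adj_kernel \<kappa>) \<psi> y)"
        unfolding kernel_op_def Bochner_Integration.integral_cnj[symmetric] by (rule integral_mult_right_zero)
      finally show ?thesis .
    qed
    then show ?thesis by (simp add: l2_inner_def)
  qed
  finally show ?thesis .
qed

end

subsection \<open>Regularized solutions of the antenna problem\<close>

lemma adjoint_on_spec:
  assumes "\<eta> \<in> H" "\<And>\<phi>. \<phi> \<in> H \<Longrightarrow> ipG (T \<phi>) \<psi> = ipH \<phi> \<eta>"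
  shows "adjoint_on H ipH ipG T \<psi> \<in> H"
    and "\<phi> \<in> H \<Longrightarrow> ipG (T \<phi>) \<psi> = ipH \<phi> (adjoint_on H ipH ipG T \<psi>)"
proof -
  have "\<exists>\<eta>. \<eta> \<in> H \<and> (\<forall>\<phi>\<in>H. ipG (T \<phi>) \<psi> = ipH \<phi> \<eta>)" using assms by blast
  from someI_ex[OF this] show "adjoint_on H ipH ipG T \<psi> \<in> H"
    and "\<phi> \<in> H \<Longrightarrow> ipG (T \<phi>) \<psi> = ipH \<phi> (adjoint_on H ipH ipG T \<psi>)"
    unfolding adjoint_on_def by blast+
qed

text \<open>The predicates under the choice coincide, so the chosen adjoints are equal as functions,
  not just almost everywhere. This allows the adjoint of K1 to be recovered from the restricted map
  in \<open>K_operator\<close>.\<close>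

lemma adjoint_on_cong:
  "(\<And>\<phi>. \<phi> \<in> H \<Longrightarrow> F \<phi> = G \<phi>) \<Longrightarrow> adjoint_on H ipH ipG F = adjoint_on H ipH ipG G"
  unfolding adjoint_on_def by (intro ext arg_cong[where f = Eps]) auto

lemma Xi_inner_commute: "Xi_inner M N q p = cnj (Xi_inner M N p q)"
  unfolding Xi_inner_def by (simp add: l2_inner_commute[of _ "fst q"] l2_inner_commute[of _ "snd q"])

lemma quadratic_root_bound:
  fixes r b X :: real
  assumes "r\<^sup>2 \<le> b * r + X"
  shows "r \<le> (b + sqrt (b\<^sup>2 + 4 * X)) / 2"
proof -
  have "(2 * r - b)\<^sup>2 \<le> b\<^sup>2 + 4 * X"
    using assms by (simp add: power2_eq_square algebra_simps)
  then have "2 * r - b \<le> sqrt (b\<^sup>2 + 4 * X)" by (rule real_le_rsqrt)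
  then show ?thesis by simp
qed

lemma compact_measure_arc_measure:
  assumes "bounded D" "hausdorff1 (frontier D) < \<infinity>"
  shows "compact_measure (arc_measure D) (frontier D)"
proof -
  interpret finite_measure "arc_measure D" using assms(2) by (rule finite_measure_arc_measure)
  show ?thesis
    by unfold_locales (simp_all add: sets_arc_measure compact_frontier_bounded assms(1))
qed

section \<open>The operators K1, K2, K and their adjoints\<close>

locale antenna =
  fixes k R :: real and Da Dc :: "plane set"
  assumes setting: "antenna_setting k R Da Dc"
begin

abbreviation "A \<equiv> arc_measure Da"
abbreviation "B \<equiv> arc_measure Dc"
abbreviation "N \<equiv> arc_measure (ball 0 R)"
abbreviation "\<kappa> \<equiv> normal_deriv_Phi k Da"

lemma R_pos: "0 < R" using setting by (simp add: antenna_setting_def)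

lemma bounded_Da: "bounded Da" and bounded_Dc: "bounded Dc"
proof -
  have "closure Da \<subseteq> ball 0 R" "closure Dc \<subseteq> ball 0 R"
    using setting by (simp_all add: antenna_setting_def)
  then show "bounded Da" "bounded Dc"
    using closure_subset bounded_ball bounded_subset by metis+
qed

lemma compact_kernel:
  assumes "compact_measure (arc_measure E) (frontier E)" "frontier E \<inter> frontier Da = {}"
  shows "compact_kernel A (frontier Da) (arc_measure E) (frontier E) \<kappa>"
proof -
  have Da: "C2_boundary Da" "0 < k" using setting by (simp_all add: antenna_setting_def)
  have "compact_measure A (frontier Da)"
    by (intro compact_measure_arc_measure bounded_Da finite_length_hausdorff1_finite C2_boundary_finite_length Da)
  then show ?thesis
    using assms continuous_on_normal_deriv_Phi[OF Da(2,1) assms(2)]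
    by (simp add: compact_kernel_def compact_kernel_axioms_def)
qed

sublocale Kc: compact_kernel A "frontier Da" B "frontier Dc" \<kappa>
proof (intro compact_kernel compact_measure_arc_measure bounded_Dc)
  show "hausdorff1 (frontier Dc) < \<infinity>" "frontier Dc \<inter> frontier Da = {}"
    using setting by (auto simp: antenna_setting_def frontier_def)
qed

sublocale Kb: compact_kernel A "frontier Da" N "frontier (ball 0 R)" \<kappa>
proof (intro compact_kernel compact_measure_arc_measure bounded_ball)
  show "hausdorff1 (frontier (ball (0::plane) R)) < \<infinity>"
    using R_pos finite_length_hausdorff1_finite[OF finite_length_sphere] by (simp add: frontier_ball)
  have "closure Da \<subseteq> ball 0 R" using setting by (simp add: antenna_setting_def)
  then show "frontier (ball 0 R) \<inter> frontier Da = {}"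
    using R_pos by (fastforce simp: frontier_ball frontier_def[of Da])
qed

sublocale Kc': compact_kernel B "frontier Dc" A "frontier Da" "adj_kernel \<kappa>"
  by (rule Kc.adjoint_kernel)

sublocale Kb': compact_kernel N "frontier (ball 0 R)" A "frontier Da" "adj_kernel \<kappa>"
  by (rule Kb.adjoint_kernel)

abbreviation "k1 \<equiv> K1 k Da Dc"
abbreviation "k2 \<equiv> K2 k R Da"

text \<open>\<open>restrict\<close> makes \<open>K1\<close> and \<open>K2\<close> undefined off
  their boundaries, so they agree with the kernel operator only on the space of the measure. Norms
  and inner products see no more than that.\<close>

lemma k1_eq: "x \<in> space B \<Longrightarrow> k1 \<phi> x = kernel_op A \<kappa> \<phi> x"
  and k2_eq: "x \<in> space N \<Longrightarrow> k2 \<phi> x = kernel_op A \<kappa> \<phi> x"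
  by (simp_all add: K1_def K2_def double_layer_def kernel_op_def Kc.B.space_A Kb.B.space_A)

lemma k1_norm: "l2_norm B (k1 \<phi>) = l2_norm B (kernel_op A \<kappa> \<phi>)"
  and k2_norm: "l2_norm N (k2 \<phi>) = l2_norm N (kernel_op A \<kappa> \<phi>)"
  by (rule l2_norm_cong, erule k1_eq, rule l2_norm_cong, erule k2_eq)

lemma k1_l2: "\<phi> \<in> l2 A \<Longrightarrow> k1 \<phi> \<in> l2 B" and k2_l2: "\<phi> \<in> l2 A \<Longrightarrow> k2 \<phi> \<in> l2 N"
  using l2_cong[OF Kc.kernel_op_l2 k1_eq] l2_cong[OF Kb.kernel_op_l2 k2_eq] by auto

lemma K_Xi: "\<phi> \<in> l2 A \<Longrightarrow> K k R Da Dc \<phi> \<in> Xi B N"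
  by (simp add: K_def Xi_def k1_l2 k2_l2)

lemma k1_diff:
  assumes "u \<in> l2 A" "v \<in> l2 A" "x \<in> space B"
  shows "k1 (\<lambda>y. u y - v y) x = k1 u x - k1 v x"
  using Kc.kernel_op_linear[OF assms(1,2), of x 1 "-1"] assms(3) by (simp add: k1_eq Kc.B.space_A)

lemma k2_diff:
  assumes "u \<in> l2 A" "v \<in> l2 A" "x \<in> space N"
  shows "k2 (\<lambda>y. u y - v y) x = k2 u x - k2 v x"
  using Kb.kernel_op_linear[OF assms(1,2), of x 1 "-1"] assms(3) by (simp add: k2_eq Kb.B.space_A)

lemma k1_adjoint:
  assumes "\<phi> \<in> l2 A" "\<psi> \<in> l2 B"
  shows "l2_inner B (k1 \<phi>) \<psi> = l2_inner A \<phi> (kernel_op B (adj_kernel \<kappa>) \<psi>)"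
  unfolding Kc.kernel_op_adjoint[OF assms, symmetric] by (rule l2_inner_cong) (simp_all add: k1_eq)

lemma k2_adjoint:
  assumes "\<phi> \<in> l2 A" "\<psi> \<in> l2 N"
  shows "l2_inner N (k2 \<phi>) \<psi> = l2_inner A \<phi> (kernel_op N (adj_kernel \<kappa>) \<psi>)"
  unfolding Kb.kernel_op_adjoint[OF assms, symmetric] by (rule l2_inner_cong) (simp_all add: k2_eq)

text \<open>The integral operator with kernel \<open>adj_kernel \<kappa>\<close> is the witness that
  makes the choice in \<open>adjoint_on\<close> meaningful.\<close>

lemma K1_adj_l2: "\<psi> \<in> l2 B \<Longrightarrow> K1_adj k Da Dc \<psi> \<in> l2 A"
  and K1_adj_inner: "\<psi> \<in> l2 B \<Longrightarrow> \<phi> \<in> l2 A \<Longrightarrow> l2_inner B (k1 \<phi>) \<psi> = l2_inner A \<phi> (K1_adj k Da Dc \<psi>)"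
  unfolding K1_adj_def
  using adjoint_on_spec[OF Kc'.kernel_op_l2, where ipH = "l2_inner A" and ipG = "l2_inner B" and T = k1]
    k1_adjoint by blast+

text \<open>The continuous representative of the adjoint of K; the chosen \<open>K_adj\<close>
  equals it only almost everywhere.\<close>

definition Kstar :: "field \<times> field \<Rightarrow> field" where
  "Kstar p y = kernel_op B (adj_kernel \<kappa>) (fst p) y + kernel_op N (adj_kernel \<kappa>) (snd p) y"

lemma Kstar_continuous: "p \<in> Xi B N \<Longrightarrow> continuous_on (frontier Da) (Kstar p)"
  unfolding Kstar_def[abs_def] Xi_def
  by (intro continuous_intros Kc'.continuous_on_kernel_op Kb'.continuous_on_kernel_op) auto

lemma Kstar_l2: "p \<in> Xi B N \<Longrightarrow> Kstar p \<in> l2 A"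
  by (intro Kc.A.l2_continuous Kstar_continuous)

lemma Kstar_inner:
  assumes "\<phi> \<in> l2 A" "p \<in> Xi B N"
  shows "Xi_inner B N (K k R Da Dc \<phi>) p = l2_inner A \<phi> (Kstar p)"
  using assms k1_adjoint[OF assms(1)] k2_adjoint[OF assms(1)]
    l2_inner_add_right[OF Kc'.kernel_op_l2 Kb'.kernel_op_l2 assms(1)]
  by (auto simp: Xi_inner_def K_def Xi_def Kstar_def[abs_def])

lemma K_adj_l2: "p \<in> Xi B N \<Longrightarrow> K_adj k R Da Dc p \<in> l2 A"
  and K_adj_inner: "p \<in> Xi B N \<Longrightarrow> \<phi> \<in> l2 A \<Longrightarrow>
    Xi_inner B N (K k R Da Dc \<phi>) p = l2_inner A \<phi> (K_adj k R Da Dc p)"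
  unfolding K_adj_def
  using adjoint_on_spec[OF Kstar_l2, where ipH = "l2_inner A" and ipG = "Xi_inner B N" and T = "K k R Da Dc"]
    Kstar_inner by blast+

lemma K_adj_AE: "p \<in> Xi B N \<Longrightarrow> AE y in A. K_adj k R Da Dc p y = Kstar p y"
  by (rule l2_eq_AE[OF K_adj_l2 Kstar_l2]) (simp_all flip: K_adj_inner Kstar_inner)

section \<open>Existence and weak form of the regularized solution\<close>

text \<open>With \<open>Kstar\<close> in place of \<open>K_adj\<close> the equation can be solved at
  every boundary point by a continuous function. Only then is it transferred to
  \<open>K_adj\<close>, at the cost of a null set.\<close>

lemma tikhonov_exists:
  assumes p: "p \<in> Xi B N" and \<alpha>: "0 < \<alpha>"
  obtains \<phi> where "\<phi> \<in> l2 A" "continuous_on (frontier Da) \<phi>"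
    "AE y in A. of_real \<alpha> * \<phi> y + K_adj k R Da Dc (K k R Da Dc \<phi>) y = K_adj k R Da Dc p y"
proof -
  let ?P = "\<lambda>u. Kstar (K k R Da Dc u)"
  let ?j1 = "\<lambda>u. kernel_op B (adj_kernel \<kappa>) (k1 u)" and ?j2 = "\<lambda>u. kernel_op N (adj_kernel \<kappa>) (k2 u)"
  obtain c1 where c1: "0 \<le> c1" "\<And>\<phi>. \<phi> \<in> l2 A \<Longrightarrow> l2_norm B (kernel_op A \<kappa> \<phi>) \<le> c1 * l2_norm A \<phi>"
    using Kc.kernel_op_l2_bounded by blast
  obtain c2 where c2: "0 \<le> c2" "\<And>\<phi>. \<phi> \<in> l2 A \<Longrightarrow> l2_norm N (kernel_op A \<kappa> \<phi>) \<le> c2 * l2_norm A \<phi>"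
    using Kb.kernel_op_l2_bounded by blast
  obtain d1 where d1: "0 \<le> d1" "\<And>\<psi> y. \<psi> \<in> l2 B \<Longrightarrow> y \<in> frontier Da \<Longrightarrow>
      cmod (kernel_op B (adj_kernel \<kappa>) \<psi> y) \<le> d1 * l2_norm B \<psi>"
    using Kc'.kernel_op_bounded by blast
  obtain d2 where d2: "0 \<le> d2" "\<And>\<psi> y. \<psi> \<in> l2 N \<Longrightarrow> y \<in> frontier Da \<Longrightarrow>
      cmod (kernel_op N (adj_kernel \<kappa>) \<psi> y) \<le> d2 * l2_norm N \<psi>"
    using Kb'.kernel_op_bounded by blast
  define m where "m = sqrt (measure A (frontier Da))"
  have m: "0 \<le> m" by (simp add: m_def)
  have P_eq: "?P u y = ?j1 u y + ?j2 u y" for u y by (simp add: Kstar_def K_def)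
  have k1n: "l2_norm B (k1 u) \<le> c1 * l2_norm A u" if "u \<in> l2 A" for u
    using c1(2)[OF that] by (simp add: k1_norm)
  have k2n: "l2_norm N (k2 u) \<le> c2 * l2_norm A u" if "u \<in> l2 A" for u
    using c2(2)[OF that] by (simp add: k2_norm)
  have sup: "cmod (?P u y) \<le> d1 * l2_norm B (k1 u) + d2 * l2_norm N (k2 u)"
    if "u \<in> l2 A" "y \<in> frontier Da" for u y
    unfolding P_eq using d1(2)[OF k1_l2 that(2)] d2(2)[OF k2_l2 that(2)] that(1)
    by (intro order_trans[OF norm_triangle_ineq] add_mono) auto
  obtain \<phi> where \<phi>: "continuous_on (frontier Da) \<phi>"
    "\<And>y. y \<in> frontier Da \<Longrightarrow> of_real \<alpha> * \<phi> y + ?P \<phi> y = Kstar p y"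
  \<comment> \<open>\<open>c\<close> composes the pointwise bounds of the adjoints with the L2
    bounds of K1 and K2. For \<open>d\<close>: the norm of \<open>?P u\<close> is at most
    \<open>m * (d1 + d2) * (n1 + n2)\<close>, while the inner product of \<open>?P u\<close> with
    \<open>u\<close> is \<open>n1\<^sup>2 + n2\<^sup>2\<close>, which is at least half of
    \<open>(n1 + n2)\<^sup>2\<close>. The added 1 keeps \<open>d\<close> positive.\<close>
  proof (rule Kc.A.second_kind_equation_solvable[where P = ?P and \<alpha> = \<alpha> and g = "Kstar p"
        and c = "d1 * c1 + d2 * c2" and d = "2 * (m * (d1 + d2))\<^sup>2 + 1"])
    fix u v :: field and a b :: complex and y
    assume uv: "u \<in> l2 A" "v \<in> l2 A" and y: "y \<in> frontier Da"
    have "?j1 (\<lambda>x. a * u x + b * v x) = kernel_op B (adj_kernel \<kappa>) (\<lambda>x. a * k1 u x + b * k1 v x)"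
      using Kc.kernel_op_linear[OF uv] by (intro kernel_op_cong) (simp add: k1_eq Kc.B.space_A)
    moreover have "?j2 (\<lambda>x. a * u x + b * v x) = kernel_op N (adj_kernel \<kappa>) (\<lambda>x. a * k2 u x + b * k2 v x)"
      using Kb.kernel_op_linear[OF uv] by (intro kernel_op_cong) (simp add: k2_eq Kb.B.space_A)
    ultimately show "?P (\<lambda>x. a * u x + b * v x) y = a * ?P u y + b * ?P v y"
      using Kc'.kernel_op_linear[OF k1_l2[OF uv(1)] k1_l2[OF uv(2)] y]
        Kb'.kernel_op_linear[OF k2_l2[OF uv(1)] k2_l2[OF uv(2)] y]
      by (simp add: P_eq algebra_simps)
  next
    fix u assume u: "u \<in> l2 A"
    then show cont: "continuous_on (frontier Da) (?P u)" by (intro Kstar_continuous K_Xi)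
    define n1 n2 where "n1 = l2_norm B (k1 u)" and "n2 = l2_norm N (k2 u)"
    have n: "0 \<le> n1" "0 \<le> n2" by (simp_all add: n1_def n2_def l2_norm_nonneg)
    have "l2_inner A u (?P u) = of_real (n1\<^sup>2 + n2\<^sup>2)"
      using Kstar_inner[OF u K_Xi[OF u]] by (simp add: Xi_inner_def K_def l2_inner_self n1_def n2_def)
    then have Re: "Re (l2_inner A (?P u) u) = n1\<^sup>2 + n2\<^sup>2"
      by (simp add: l2_inner_commute[of A "?P u"])
    have "l2_norm A (?P u) \<le> (d1 * n1 + d2 * n2) * m"
      unfolding m_def using sup[OF u] d1(1) d2(1) n cont
      by (intro Kc.A.l2_norm_le_sup) (auto simp: n1_def n2_def)
    also have "\<dots> \<le> m * (d1 + d2) * (n1 + n2)"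
      using m d1(1) d2(1) n by (simp add: algebra_simps)
    finally have "(l2_norm A (?P u))\<^sup>2 \<le> (m * (d1 + d2) * (n1 + n2))\<^sup>2"
      by (intro power_mono l2_norm_nonneg)
    also have "\<dots> = (m * (d1 + d2))\<^sup>2 * (n1 + n2)\<^sup>2" by (simp add: power_mult_distrib)
    also have "\<dots> \<le> (m * (d1 + d2))\<^sup>2 * (2 * (n1\<^sup>2 + n2\<^sup>2))"
      using zero_le_power2[of "n1 - n2"]
      by (intro mult_left_mono) (simp_all add: power2_sum power2_diff)
    also have "\<dots> \<le> (2 * (m * (d1 + d2))\<^sup>2 + 1) * (n1\<^sup>2 + n2\<^sup>2)"
      by (simp add: algebra_simps)
    finally show "(l2_norm A (?P u))\<^sup>2 \<le> (2 * (m * (d1 + d2))\<^sup>2 + 1) * Re (l2_inner A (?P u) u)"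
      unfolding Re .
    fix y assume y: "y \<in> frontier Da"
    have "d1 * n1 + d2 * n2 \<le> d1 * (c1 * l2_norm A u) + d2 * (c2 * l2_norm A u)"
      unfolding n1_def n2_def using k1n[OF u] k2n[OF u] d1(1) d2(1) by (intro add_mono mult_left_mono)
    then show "cmod (?P u y) \<le> (d1 * c1 + d2 * c2) * l2_norm A u"
      using sup[OF u y] by (simp add: n1_def n2_def algebra_simps)
  next
    show "0 \<le> d1 * c1 + d2 * c2" using c1(1) c2(1) d1(1) d2(1) by simp
    show "0 < 2 * (m * (d1 + d2))\<^sup>2 + 1" by (simp add: add_nonneg_pos)
  qed (use \<alpha> Kstar_continuous[OF p] in auto)
  have l2: "\<phi> \<in> l2 A" using \<phi>(1) by (rule Kc.A.l2_continuous)
  have "AE y in A. of_real \<alpha> * \<phi> y + ?P \<phi> y = Kstar p y"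
    using \<phi>(2) by (intro AE_I2) (simp add: Kc.A.space_A)
  then have "AE y in A. of_real \<alpha> * \<phi> y + K_adj k R Da Dc (K k R Da Dc \<phi>) y = K_adj k R Da Dc p y"
    using K_adj_AE[OF p] K_adj_AE[OF K_Xi[OF l2]] by eventually_elim simp
  with l2 \<phi>(1) show ?thesis by (rule that)
qed

lemma tikhonov_spec:
  assumes "p \<in> Xi B N" "0 < \<alpha>"
  shows "tikhonov k R Da Dc \<alpha> p \<in> l2 A"
    and "AE y in A. of_real \<alpha> * tikhonov k R Da Dc \<alpha> p y
      + K_adj k R Da Dc (K k R Da Dc (tikhonov k R Da Dc \<alpha> p)) y = K_adj k R Da Dc p y"
proof -
  have "\<exists>\<phi>. \<phi> \<in> l2 A \<and> continuous_on (frontier Da) \<phi> \<and>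
     (AE y in A. of_real \<alpha> * \<phi> y + K_adj k R Da Dc (K k R Da Dc \<phi>) y = K_adj k R Da Dc p y)"
    by (rule tikhonov_exists[OF assms]) (rule exI, intro conjI)
  from someI_ex[OF this] show "tikhonov k R Da Dc \<alpha> p \<in> l2 A"
    and "AE y in A. of_real \<alpha> * tikhonov k R Da Dc \<alpha> p y
      + K_adj k R Da Dc (K k R Da Dc (tikhonov k R Da Dc \<alpha> p)) y = K_adj k R Da Dc p y"
    unfolding tikhonov_def by blast+
qed

text \<open>The normal equation tested with \<open>w\<close>, the adjoint moved across. In this form
  neither the choice of \<open>K_adj\<close> nor its null sets are visible any more.\<close>

lemma tikhonov_weak:
  assumes p: "p \<in> Xi B N" and \<alpha>: "0 < \<alpha>" and w: "w \<in> l2 A"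
    and \<phi>: "\<phi> = tikhonov k R Da Dc \<alpha> p"
  shows "of_real \<alpha> * l2_inner A \<phi> w + Xi_inner B N (K k R Da Dc \<phi>) (K k R Da Dc w)
    = Xi_inner B N p (K k R Da Dc w)"
proof -
  have \<phi>_l2: "\<phi> \<in> l2 A" unfolding \<phi> using p \<alpha> by (rule tikhonov_spec)
  have adj: "l2_inner A (K_adj k R Da Dc q) w = Xi_inner B N q (K k R Da Dc w)" if "q \<in> Xi B N" for q
    using K_adj_inner[OF that w] by (simp add: l2_inner_commute[of A "K_adj k R Da Dc q"] Xi_inner_commute[of B N q])
  have K\<phi>: "K k R Da Dc \<phi> \<in> Xi B N" using \<phi>_l2 by (rule K_Xi)
  have "l2_inner A (\<lambda>y. of_real \<alpha> * \<phi> y + 1 * K_adj k R Da Dc (K k R Da Dc \<phi>) y) w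
      = l2_inner A (K_adj k R Da Dc p) w"
    using tikhonov_spec(2)[OF p \<alpha>]
    by (intro l2_inner_cong_AE l2_linear_combination \<phi>_l2 K_adj_l2 p w K\<phi>) (simp add: \<phi>)
  then show ?thesis
    unfolding l2_inner_linear_left[OF \<phi>_l2 K_adj_l2[OF K\<phi>] w] by (simp add: adj K\<phi> p)
qed

section \<open>The operator norm of the adjoint of K1\<close>

text \<open>\<open>l2_opnorm\<close> is a supremum of reals, informative only when the set is
  bounded above. For an adjoint image \<open>u\<close> of a unit vector \<open>f\<close>, the
  squared norm of \<open>u\<close> is the inner product of \<open>k1 u\<close> with
  \<open>f\<close>, hence at most \<open>c\<close> times the norm of \<open>u\<close>.\<close>

lemma opnorm_upper:
  assumes "g \<in> l2 B" "l2_norm B g \<le> 1"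
  shows "l2_norm A (K1_adj k Da Dc g) \<le> l2_opnorm B A (K1_adj k Da Dc)"
proof -
  obtain c where c: "0 \<le> c" "\<And>\<phi>. \<phi> \<in> l2 A \<Longrightarrow> l2_norm B (kernel_op A \<kappa> \<phi>) \<le> c * l2_norm A \<phi>"
    using Kc.kernel_op_l2_bounded by blast
  have "l2_norm A (K1_adj k Da Dc f) \<le> c" if f: "f \<in> l2 B" "l2_norm B f \<le> 1" for f
  proof -
    define u where "u = K1_adj k Da Dc f"
    have u: "u \<in> l2 A" unfolding u_def using f(1) by (rule K1_adj_l2)
    have "of_real ((l2_norm A u)\<^sup>2) = l2_inner B (k1 u) f"
      unfolding l2_inner_self[symmetric] using K1_adj_inner[OF f(1) u] by (simp add: u_def)
    then have "(l2_norm A u)\<^sup>2 = cmod (l2_inner B (k1 u) f)"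
      by (metis abs_power2 norm_of_real)
    also have "\<dots> \<le> l2_norm B (k1 u) * l2_norm B f"
      using k1_l2[OF u] f(1) by (rule l2_cauchy_schwarz)
    also have "\<dots> \<le> l2_norm B (k1 u) * 1"
      using f(2) l2_norm_nonneg by (rule mult_left_mono)
    also have "\<dots> \<le> c * l2_norm A u"
      using c(2)[OF u] by (simp add: k1_norm)
    finally have "l2_norm A u * l2_norm A u \<le> c * l2_norm A u" by (simp add: power2_eq_square)
    then show ?thesis
      using c(1) l2_norm_nonneg[of A u] by (cases "l2_norm A u = 0") (auto simp: u_def)
  qed
  then have "bdd_above ((\<lambda>f. l2_norm A (K1_adj k Da Dc f)) ` {f \<in> l2 B. l2_norm B f \<le> 1})"
    by (intro bdd_aboveI2[of _ _ c]) auto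
  then show ?thesis
    unfolding l2_opnorm_def by (rule cSUP_upper2[where x = g]) (use assms in auto)
qed

text \<open>One half of the equality between the norms of K1 and its adjoint: the adjoint is tested
  on the normalized function \<open>k1 \<phi>\<close>.\<close>

lemma k1_norm_le:
  assumes \<phi>: "\<phi> \<in> l2 A"
  shows "l2_norm B (k1 \<phi>) \<le> l2_opnorm B A (K1_adj k Da Dc) * l2_norm A \<phi>"
proof (cases "l2_norm B (k1 \<phi>) = 0")
  case True
  have "(\<lambda>x. 0) \<in> l2 B" by (intro Kc.B.l2_continuous continuous_intros)
  moreover have "l2_norm B (\<lambda>x. 0) \<le> 1" by (simp add: l2_norm_def)
  ultimately have "0 \<le> l2_opnorm B A (K1_adj k Da Dc)"
    using opnorm_upper l2_norm_nonneg order_trans by blast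
  then show ?thesis using True l2_norm_nonneg[of A \<phi>] by simp
next
  case False
  define m where "m = l2_norm B (k1 \<phi>)"
  have m: "0 < m" using False l2_norm_nonneg[of B "k1 \<phi>"] by (simp add: m_def less_le)
  define g where "g x = of_real (1 / m) * k1 \<phi> x" for x
  have g: "g \<in> l2 B" unfolding g_def[abs_def] using k1_l2[OF \<phi>] by (rule l2_scale)
  have "l2_norm B g = cmod (of_real (1 / m)) * m"
    unfolding g_def[abs_def] m_def by (rule l2_norm_scale)
  then have g1: "l2_norm B g \<le> 1" using m by (simp add: norm_divide)
  have "l2_inner B g (k1 \<phi>) = of_real (1 / m) * of_real (m\<^sup>2)"
    unfolding g_def[abs_def] m_def l2_inner_self[symmetric]
    using k1_l2[OF \<phi>] k1_l2[OF \<phi>] by (rule l2_inner_scale_left)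
  then have "l2_inner B (k1 \<phi>) g = of_real m"
    using m by (simp add: l2_inner_commute[of B "k1 \<phi>" g] power2_eq_square)
  then have "m = cmod (l2_inner A \<phi> (K1_adj k Da Dc g))"
    using K1_adj_inner[OF g \<phi>] m by simp
  also have "\<dots> \<le> l2_norm A \<phi> * l2_norm A (K1_adj k Da Dc g)"
    using \<phi> K1_adj_l2[OF g] by (rule l2_cauchy_schwarz)
  also have "\<dots> \<le> l2_norm A \<phi> * l2_opnorm B A (K1_adj k Da Dc)"
    using opnorm_upper[OF g g1] l2_norm_nonneg by (rule mult_left_mono)
  finally show ?thesis by (simp add: m_def mult.commute)
qed

lemma noisy_Xi:
  assumes "closure Dc \<subseteq> U" "helmholtz_solution_on k U f" "s \<in> l2 B"
  shows "noisy f s \<epsilon> \<in> Xi B N"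
proof -
  have "\<And>x. x \<in> frontier Dc \<Longrightarrow> f differentiable (at x)"
    using assms(1,2) by (auto simp: helmholtz_solution_on_def C2_on_def frontier_def)
  then have "f differentiable_on (frontier Dc)"
    by (simp add: differentiable_at_imp_differentiable_on)
  then have "f \<in> l2 B" by (intro Kc.B.l2_continuous differentiable_imp_continuous_on)
  then have "(\<lambda>x. 1 * f x + of_real \<epsilon> * s x) \<in> l2 B" using assms(3) by (rule l2_linear_combination)
  moreover have "(\<lambda>x. 0) \<in> l2 N" by (intro Kb.B.l2_continuous continuous_intros)
  ultimately show ?thesis by (simp add: noisy_def Xi_def)
qed

section \<open>Energy estimate and lower bound from the residual\<close>

text \<open>Writing \<open>\<alpha>\<^sub>\<epsilon>\<close> as \<open>\<alpha>\<^sub>0\<close> plus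
  the difference charges the mismatch of the parameters to \<open>\<phi>\<^sub>\<epsilon>\<close>,
  whose norm is the denominator of the final quotient, and leaves \<open>\<alpha>\<^sub>0\<close> as
  the coefficient on the left.\<close>

lemma tikhonov_difference_energy:
  assumes p0: "noisy f s 0 \<in> Xi B N" and p\<epsilon>: "noisy f s \<epsilon> \<in> Xi B N" and s: "s \<in> l2 B"
    and \<epsilon>: "0 \<le> \<epsilon>" and \<alpha>: "0 < \<alpha>\<^sub>0" "0 < \<alpha>\<^sub>\<epsilon>"
    and \<phi>0: "\<phi>\<^sub>0 = tikhonov k R Da Dc \<alpha>\<^sub>0 (noisy f s 0)"
    and \<phi>\<epsilon>: "\<phi>\<^sub>\<epsilon> = tikhonov k R Da Dc \<alpha>\<^sub>\<epsilon> (noisy f s \<epsilon>)"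
  shows "\<alpha>\<^sub>0 * (l2_norm A (\<lambda>y. \<phi>\<^sub>\<epsilon> y - \<phi>\<^sub>0 y))\<^sup>2
    \<le> \<bar>\<alpha>\<^sub>\<epsilon> - \<alpha>\<^sub>0\<bar> * (l2_norm A \<phi>\<^sub>\<epsilon> * l2_norm A (\<lambda>y. \<phi>\<^sub>\<epsilon> y - \<phi>\<^sub>0 y)) + (\<epsilon> * l2_norm B s)\<^sup>2 / 4"
proof -
  have l0: "\<phi>\<^sub>0 \<in> l2 A" and l\<epsilon>: "\<phi>\<^sub>\<epsilon> \<in> l2 A"
    unfolding \<phi>0 \<phi>\<epsilon> using tikhonov_spec(1) p0 p\<epsilon> \<alpha> by blast+
  define w where "w = (\<lambda>y. \<phi>\<^sub>\<epsilon> y - \<phi>\<^sub>0 y)"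
  have w: "w \<in> l2 A" unfolding w_def using l\<epsilon> l0 by (rule l2_diff)
  define a where "a = l2_norm B (k1 w)"
  have k1w: "l2_inner B (k1 \<phi>\<^sub>\<epsilon>) (k1 w) - l2_inner B (k1 \<phi>\<^sub>0) (k1 w) = of_real (a\<^sup>2)"
    unfolding a_def l2_inner_self[symmetric] l2_inner_diff_left[OF k1_l2[OF l\<epsilon>] k1_l2[OF l0] k1_l2[OF w], symmetric]
    by (rule l2_inner_cong) (simp_all add: w_def k1_diff[OF l\<epsilon> l0])
  have k2w: "l2_inner N (k2 \<phi>\<^sub>\<epsilon>) (k2 w) - l2_inner N (k2 \<phi>\<^sub>0) (k2 w) = of_real ((l2_norm N (k2 w))\<^sup>2)"
    unfolding l2_inner_self[symmetric] l2_inner_diff_left[OF k2_l2[OF l\<epsilon>] k2_l2[OF l0] k2_l2[OF w], symmetric]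
    by (rule l2_inner_cong) (simp_all add: w_def k2_diff[OF l\<epsilon> l0])
  have f: "f \<in> l2 B" using p0 by (simp add: noisy_def Xi_def)
  have data: "l2_inner B (\<lambda>x. f x + of_real \<epsilon> * s x) (k1 w) - l2_inner B f (k1 w) = of_real \<epsilon> * l2_inner B s (k1 w)"
    using l2_inner_linear_left[OF f s k1_l2[OF w], of 1 "of_real \<epsilon>"] by simp
  have ww: "l2_inner A \<phi>\<^sub>\<epsilon> w - l2_inner A \<phi>\<^sub>0 w = of_real ((l2_norm A w)\<^sup>2)"
    unfolding l2_inner_self[symmetric] l2_inner_diff_left[OF l\<epsilon> l0 w, symmetric] by (simp add: w_def)
  have "of_real \<alpha>\<^sub>0 * (l2_inner A \<phi>\<^sub>\<epsilon> w - l2_inner A \<phi>\<^sub>0 w)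
      + (l2_inner B (k1 \<phi>\<^sub>\<epsilon>) (k1 w) - l2_inner B (k1 \<phi>\<^sub>0) (k1 w))
      + (l2_inner N (k2 \<phi>\<^sub>\<epsilon>) (k2 w) - l2_inner N (k2 \<phi>\<^sub>0) (k2 w))
      = (l2_inner B (\<lambda>x. f x + of_real \<epsilon> * s x) (k1 w) - l2_inner B f (k1 w))
      + (of_real \<alpha>\<^sub>0 - of_real \<alpha>\<^sub>\<epsilon>) * l2_inner A \<phi>\<^sub>\<epsilon> w"
    using tikhonov_weak[OF p\<epsilon> \<alpha>(2) w \<phi>\<epsilon>] tikhonov_weak[OF p0 \<alpha>(1) w \<phi>0]
    by (simp add: Xi_inner_def K_def noisy_def) (simp add: algebra_simps)
  then have "of_real (\<alpha>\<^sub>0 * (l2_norm A w)\<^sup>2 + a\<^sup>2 + (l2_norm N (k2 w))\<^sup>2)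
      = of_real \<epsilon> * l2_inner B s (k1 w) + of_real (\<alpha>\<^sub>0 - \<alpha>\<^sub>\<epsilon>) * l2_inner A \<phi>\<^sub>\<epsilon> w"
    unfolding ww k1w k2w data by simp
  then have "\<alpha>\<^sub>0 * (l2_norm A w)\<^sup>2 + a\<^sup>2 + (l2_norm N (k2 w))\<^sup>2
      = Re (of_real \<epsilon> * l2_inner B s (k1 w)) + Re (of_real (\<alpha>\<^sub>0 - \<alpha>\<^sub>\<epsilon>) * l2_inner A \<phi>\<^sub>\<epsilon> w)"
    by (metis Re_complex_of_real plus_complex.sel(1))
  also have "\<dots> \<le> cmod (of_real \<epsilon> * l2_inner B s (k1 w)) + cmod (of_real (\<alpha>\<^sub>0 - \<alpha>\<^sub>\<epsilon>) * l2_inner A \<phi>\<^sub>\<epsilon> w)"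
    by (intro add_mono complex_Re_le_cmod)
  also have "\<dots> = \<epsilon> * cmod (l2_inner B s (k1 w)) + \<bar>\<alpha>\<^sub>\<epsilon> - \<alpha>\<^sub>0\<bar> * cmod (l2_inner A \<phi>\<^sub>\<epsilon> w)"
    unfolding norm_mult norm_of_real using \<epsilon> by (simp add: abs_minus_commute)
  also have "\<dots> \<le> \<epsilon> * (l2_norm B s * a) + \<bar>\<alpha>\<^sub>\<epsilon> - \<alpha>\<^sub>0\<bar> * (l2_norm A \<phi>\<^sub>\<epsilon> * l2_norm A w)"
    unfolding a_def using \<epsilon> by (intro add_mono mult_left_mono l2_cauchy_schwarz s k1_l2 w l\<epsilon>) auto
  \<comment> \<open>Young's inequality, weighted so that \<open>a\<^sup>2\<close> cancels exactly
    against the left side.\<close>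
  also have "\<epsilon> * (l2_norm B s * a) \<le> (\<epsilon> * l2_norm B s)\<^sup>2 / 4 + a\<^sup>2"
    using zero_le_power2[of "\<epsilon> * l2_norm B s / 2 - a"] by (simp add: power2_diff power_divide)
  finally show ?thesis
    unfolding w_def[symmetric] using zero_le_power2[of "l2_norm N (k2 w)"] by linarith
qed

text \<open>Dropping the part of the residual on the outer circle leaves a misfit of at most
  \<open>\<delta>\<close> times the norm of the data on the boundary of \<open>Dc\<close>, so K1
  must reproduce the share \<open>1 - \<delta>\<close> of them. It follows also that
  \<open>\<phi>\<close> cannot vanish, so the quotient in the theorem is a genuine one.\<close>

lemma morozov_lower_bound:
  assumes p: "noisy f s \<epsilon> \<in> Xi B N" and m: "morozov k R Da Dc \<delta> (noisy f s \<epsilon>) \<alpha>"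
    and \<delta>: "0 < \<delta>" "\<delta> < 1 / sqrt 2"
    and \<phi>: "\<phi> = tikhonov k R Da Dc \<alpha> (noisy f s \<epsilon>)"
  shows "l2_norm B (fst (noisy f s \<epsilon>)) \<le> 4 * (l2_opnorm B A (K1_adj k Da Dc) * l2_norm A \<phi>)"
proof -
  define h where "h = fst (noisy f s \<epsilon>)"
  have m': "l2_norm B h \<noteq> 0" "0 < \<alpha>" "residual k R Da Dc \<phi> (noisy f s \<epsilon>) = \<delta>\<^sup>2"
    using m by (simp_all add: morozov_def Let_def h_def \<phi>)
  have h: "h \<in> l2 B" using p by (simp add: h_def noisy_def Xi_def)
  have h_pos: "0 < l2_norm B h" using m'(1) l2_norm_nonneg[of B h] by simp
  have \<phi>_l2: "\<phi> \<in> l2 A" unfolding \<phi> using p m'(2) by (rule tikhonov_spec)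
  have d: "(\<lambda>x. k1 \<phi> x - h x) \<in> l2 B" using k1_l2[OF \<phi>_l2] h by (rule l2_diff)
  have "0 \<le> 1 / (2 * pi * R) * (l2_norm N (k2 \<phi>))\<^sup>2" using R_pos by simp
  then have "1 / (l2_norm B h)\<^sup>2 * (l2_norm B (\<lambda>x. k1 \<phi> x - h x))\<^sup>2 \<le> \<delta>\<^sup>2"
    using m'(3) unfolding residual_def h_def[symmetric] by linarith
  then have "(l2_norm B (\<lambda>x. k1 \<phi> x - h x))\<^sup>2 \<le> (\<delta> * l2_norm B h)\<^sup>2"
    using h_pos by (simp add: divide_le_eq power_mult_distrib)
  then have r: "l2_norm B (\<lambda>x. k1 \<phi> x - h x) \<le> \<delta> * l2_norm B h"
    by (rule power2_le_imp_le) (use \<delta>(1) h_pos in simp)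
  have "l2_norm B (\<lambda>x. k1 \<phi> x + (- 1) * (k1 \<phi> x - h x)) \<le> l2_norm B (k1 \<phi>) + l2_norm B (\<lambda>x. (- 1) * (k1 \<phi> x - h x))"
    using k1_l2[OF \<phi>_l2] l2_scale[OF d] by (rule l2_norm_triangle)
  then have "l2_norm B h \<le> l2_norm B (k1 \<phi>) + l2_norm B (\<lambda>x. k1 \<phi> x - h x)"
    unfolding l2_norm_scale by simp
  then have "(1 - \<delta>) * l2_norm B h \<le> l2_opnorm B A (K1_adj k Da Dc) * l2_norm A \<phi>"
    using r k1_norm_le[OF \<phi>_l2] by (simp add: algebra_simps)
  \<comment> \<open>1/4 is a rational lower bound for \<open>1 - 1 / sqrt 2\<close>.\<close>
  moreover have "1 / 4 * l2_norm B h \<le> (1 - \<delta>) * l2_norm B h"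
  proof (rule mult_right_mono)
    have "4 / 3 \<le> sqrt 2" by (rule real_le_rsqrt) (simp add: power2_eq_square)
    then have "1 / sqrt 2 \<le> 3 / 4" by (simp add: field_simps)
    then show "1 / 4 \<le> 1 - \<delta>" using \<delta>(2) by simp
  qed (use h_pos in simp)
  ultimately show ?thesis unfolding h_def by linarith
qed

end

section \<open>The stability estimate\<close>

text \<open>For \<epsilon> < 1/2 the bound on \<open>s\<close> and the triangle inequality allow
  \<open>M = 1 / (1 - 2 * \<epsilon>)\<close>. From \<epsilon> = 1/2 on, \<open>s\<close> may cancel
  \<open>f1\<close> almost entirely, and \<open>M\<close> records how much of the data survives.
  \<open>C\<close> is chosen after \<open>M\<close> but before geometry, wave number and data, so it
  can depend on these only through its arguments.\<close>

theorem proposition3p1: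
  fixes M :: real
  shows "\<exists>C :: operator \<Rightarrow> real \<Rightarrow> real \<Rightarrow> real.
    (\<forall>T d\<^sub>c d. 0 < C T d\<^sub>c d) \<and>
    (\<forall>k R Da Dc U f1 s \<delta> \<epsilon> \<alpha>\<^sub>0 \<alpha>\<^sub>\<epsilon>.
       antenna_setting k R Da Dc \<longrightarrow>
       0 < \<delta> \<longrightarrow> \<delta> < 1 / sqrt 2 \<longrightarrow>
       open U \<longrightarrow> closure Dc \<subseteq> U \<longrightarrow> helmholtz_solution_on k U f1 \<longrightarrow>
       s \<in> l2 (arc_measure Dc) \<longrightarrow>
       l2_norm (arc_measure Dc) s \<le> 2 * l2_norm (arc_measure Dc) f1 \<longrightarrow>
       0 \<le> \<epsilon> \<longrightarrow>
       l2_norm (arc_measure Dc) f1 \<le> M * l2_norm (arc_measure Dc) (fst (noisy f1 s \<epsilon>)) \<longrightarrow>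
       morozov k R Da Dc \<delta> (noisy f1 s 0) \<alpha>\<^sub>0 \<longrightarrow>
       morozov k R Da Dc \<delta> (noisy f1 s \<epsilon>) \<alpha>\<^sub>\<epsilon> \<longrightarrow>
       (let \<phi>\<^sub>0 = tikhonov k R Da Dc \<alpha>\<^sub>0 (noisy f1 s 0);
            \<phi>\<^sub>\<epsilon> = tikhonov k R Da Dc \<alpha>\<^sub>\<epsilon> (noisy f1 s \<epsilon>);
            c = C (K_operator k R Da Dc) (diameter Dc) (setdist (frontier Dc) (frontier Da));
            b = \<bar>\<alpha>\<^sub>\<epsilon> / \<alpha>\<^sub>0 - 1\<bar>
        in l2_norm (arc_measure Da) (\<lambda>y. \<phi>\<^sub>\<epsilon> y - \<phi>\<^sub>0 y) / l2_norm (arc_measure Da) \<phi>\<^sub>\<epsilon>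
           \<le> (b + sqrt (b\<^sup>2 + 16 * (\<epsilon> * (2 * \<delta> + c * \<delta> * \<epsilon> + c * \<epsilon>) / \<alpha>\<^sub>0)
                 * l2_opnorm (arc_measure Dc) (arc_measure Da) (K1_adj k Da Dc))) / 2))"
proof -
  \<comment> \<open>\<open>C\<close> sees only the operator, so the adjoint of K1 is rebuilt from
    the first component of the map. The factor \<open>4 * M\<^sup>2\<close> is what the comparison
    of \<open>16 * (\<epsilon> * M * n)\<^sup>2\<close> with
    \<open>4 * (\<epsilon> * (c * \<epsilon>)) * n\<close> asks for. The 1 and the absolute value
    give positivity for every \<open>T\<close>, including those whose \<open>l2_opnorm\<close> is an
    arbitrary real.\<close>
  define C :: "operator \<Rightarrow> real \<Rightarrow> real \<Rightarrow> real" where "C T d\<^sub>c d = (case T of (A, B, _, F) \<Rightarrow>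
    1 + 4 * M\<^sup>2 * \<bar>l2_opnorm B A (adjoint_on (l2 A) (l2_inner A) (l2_inner B) (\<lambda>\<phi>. fst (F \<phi>)))\<bar>)" for T d\<^sub>c d
  have C_pos: "0 < C T d\<^sub>c d" for T d\<^sub>c d
    by (cases T) (simp add: C_def add_pos_nonneg)
  have bound: "l2_norm (arc_measure Da) (\<lambda>y. \<phi>\<^sub>\<epsilon> y - \<phi>\<^sub>0 y) / l2_norm (arc_measure Da) \<phi>\<^sub>\<epsilon>
      \<le> (\<bar>\<alpha>\<^sub>\<epsilon> / \<alpha>\<^sub>0 - 1\<bar> + sqrt (\<bar>\<alpha>\<^sub>\<epsilon> / \<alpha>\<^sub>0 - 1\<bar>\<^sup>2 + 16 * (\<epsilon> * (2 * \<delta> + c * \<delta> * \<epsilon> + c * \<epsilon>) / \<alpha>\<^sub>0)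
           * l2_opnorm (arc_measure Dc) (arc_measure Da) (K1_adj k Da Dc))) / 2"
    if setting: "antenna_setting k R Da Dc" and \<delta>: "0 < \<delta>" "\<delta> < 1 / sqrt 2"
      and U: "closure Dc \<subseteq> U" and f1: "helmholtz_solution_on k U f1"
      and s: "s \<in> l2 (arc_measure Dc)" "l2_norm (arc_measure Dc) s \<le> 2 * l2_norm (arc_measure Dc) f1"
      and \<epsilon>: "0 \<le> \<epsilon>"
      and M: "l2_norm (arc_measure Dc) f1 \<le> M * l2_norm (arc_measure Dc) (fst (noisy f1 s \<epsilon>))"
      and m0: "morozov k R Da Dc \<delta> (noisy f1 s 0) \<alpha>\<^sub>0"
      and m\<epsilon>: "morozov k R Da Dc \<delta> (noisy f1 s \<epsilon>) \<alpha>\<^sub>\<epsilon>"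
      and \<phi>0: "\<phi>\<^sub>0 = tikhonov k R Da Dc \<alpha>\<^sub>0 (noisy f1 s 0)"
      and \<phi>\<epsilon>: "\<phi>\<^sub>\<epsilon> = tikhonov k R Da Dc \<alpha>\<^sub>\<epsilon> (noisy f1 s \<epsilon>)"
      and c: "c = C (K_operator k R Da Dc) d\<^sub>c d"
    for k R Da Dc U f1 s \<delta> \<epsilon> \<alpha>\<^sub>0 \<alpha>\<^sub>\<epsilon> \<phi>\<^sub>0 \<phi>\<^sub>\<epsilon> c d\<^sub>c d
  proof -
    interpret antenna k R Da Dc by unfold_locales (fact setting)
    define n where "n = l2_opnorm B A (K1_adj k Da Dc)"
    have c_eq: "c = 1 + 4 * M\<^sup>2 * \<bar>n\<bar>"
    proof -
      have "adjoint_on (l2 A) (l2_inner A) (l2_inner B) (\<lambda>\<phi>. fst (restrict (K k R Da Dc) (l2 A) \<phi>)) = K1_adj k Da Dc"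
        unfolding K1_adj_def by (rule adjoint_on_cong) (simp add: K_def)
      then show ?thesis by (simp add: c C_def K_operator_def n_def)
    qed
    have \<alpha>: "0 < \<alpha>\<^sub>0" "0 < \<alpha>\<^sub>\<epsilon>" using m0 m\<epsilon> by (simp_all add: morozov_def Let_def)
    have p: "noisy f1 s \<epsilon>' \<in> Xi B N" for \<epsilon>' using U f1 s(1) by (rule noisy_Xi)
    define q w h where "q = l2_norm A \<phi>\<^sub>\<epsilon>" and "w = l2_norm A (\<lambda>y. \<phi>\<^sub>\<epsilon> y - \<phi>\<^sub>0 y)"
      and "h = l2_norm B (fst (noisy f1 s \<epsilon>))"
    have h: "0 < h" using m\<epsilon> l2_norm_nonneg[of B] by (simp add: morozov_def Let_def h_def less_le)
    have hq: "h \<le> 4 * (n * q)"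
      unfolding h_def n_def q_def using p m\<epsilon> \<delta> \<phi>\<epsilon> by (rule morozov_lower_bound)
    have "0 \<le> q" by (simp add: q_def l2_norm_nonneg)
    \<comment> \<open>The data have positive norm, so both the denominator \<open>q\<close> and the
      operator norm \<open>n\<close> are positive.\<close>
    moreover have "0 < n * q" using h hq by simp
    ultimately have q: "0 < q" and n: "0 < n" by (auto simp: zero_less_mult_iff)
    have "0 \<le> M * h" using M l2_norm_nonneg[of B f1] unfolding h_def by linarith
    then have M0: "0 \<le> M" using h by (simp add: zero_le_mult_iff)
    \<comment> \<open>The factor 2 comes from the bound on \<open>s\<close>, the 4 from the
      residual; the square of their product 8, divided by the 4 of the energy estimate, is the 16
      below.\<close>
    have "l2_norm B s \<le> 2 * (M * h)" using s(2) M unfolding h_def by linarith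
    also have "\<dots> \<le> 2 * (M * (4 * (n * q)))"
      using hq M0 by (intro mult_left_mono) auto
    finally have "\<epsilon> * l2_norm B s \<le> \<epsilon> * (8 * M * n * q)"
      using \<epsilon> by (intro mult_left_mono) (simp_all add: mult_ac)
    then have "(\<epsilon> * l2_norm B s)\<^sup>2 \<le> (\<epsilon> * (8 * M * n * q))\<^sup>2"
      using \<epsilon> l2_norm_nonneg by (intro power_mono) auto
    moreover have "\<alpha>\<^sub>0 * w\<^sup>2 \<le> \<bar>\<alpha>\<^sub>\<epsilon> - \<alpha>\<^sub>0\<bar> * (q * w) + (\<epsilon> * l2_norm B s)\<^sup>2 / 4"
      unfolding w_def q_def using p p s(1) \<epsilon> \<alpha> \<phi>0 \<phi>\<epsilon> by (rule tikhonov_difference_energy)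
    ultimately have "\<alpha>\<^sub>0 * w\<^sup>2 \<le> \<bar>\<alpha>\<^sub>\<epsilon> - \<alpha>\<^sub>0\<bar> * (q * w) + 16 * (\<epsilon> * M * n * q)\<^sup>2"
      by (simp add: power_mult_distrib)
    then have "\<alpha>\<^sub>0 * w\<^sup>2 / (\<alpha>\<^sub>0 * q\<^sup>2) \<le> (\<bar>\<alpha>\<^sub>\<epsilon> - \<alpha>\<^sub>0\<bar> * (q * w) + 16 * (\<epsilon> * M * n * q)\<^sup>2) / (\<alpha>\<^sub>0 * q\<^sup>2)"
      using \<alpha> q by (intro divide_right_mono) auto
    moreover have "\<bar>\<alpha>\<^sub>\<epsilon> / \<alpha>\<^sub>0 - 1\<bar> = \<bar>\<alpha>\<^sub>\<epsilon> - \<alpha>\<^sub>0\<bar> / \<alpha>\<^sub>0"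
    proof -
      have "\<alpha>\<^sub>\<epsilon> / \<alpha>\<^sub>0 - 1 = (\<alpha>\<^sub>\<epsilon> - \<alpha>\<^sub>0) / \<alpha>\<^sub>0" using \<alpha> by (simp add: diff_divide_distrib)
      then show ?thesis using \<alpha> by (simp add: abs_divide)
    qed
    ultimately have "(w / q)\<^sup>2 \<le> \<bar>\<alpha>\<^sub>\<epsilon> / \<alpha>\<^sub>0 - 1\<bar> * (w / q) + 16 * (\<epsilon> * M * n)\<^sup>2 / \<alpha>\<^sub>0"
      using \<alpha> q by (simp add: field_simps power2_eq_square)
    \<comment> \<open>The term goes under the summand \<open>c * \<epsilon>\<close> of the bracket,
      because \<open>4 * M\<^sup>2 * n \<le> c\<close>. The factor 4 here and the 4 under the root
      in \<open>quadratic_root_bound\<close> make the 16 of the claim.\<close>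
    also have "16 * (\<epsilon> * M * n)\<^sup>2 / \<alpha>\<^sub>0 \<le> 4 * (\<epsilon> * (2 * \<delta> + c * \<delta> * \<epsilon> + c * \<epsilon>) / \<alpha>\<^sub>0) * n"
    proof -
      have c0: "0 < c" unfolding c by (rule C_pos)
      have "4 * M\<^sup>2 * n \<le> c" using n by (simp add: c_eq)
      then have "4 * M\<^sup>2 * n * (\<epsilon>\<^sup>2 * n) \<le> c * (\<epsilon>\<^sup>2 * n)" using n by (intro mult_right_mono) auto
      also have "\<dots> = \<epsilon> * (c * \<epsilon>) * n" by (simp add: power2_eq_square)
      also have "\<dots> \<le> \<epsilon> * (2 * \<delta> + c * \<delta> * \<epsilon> + c * \<epsilon>) * n"
        using \<epsilon> n c0 \<delta>(1) by (intro mult_right_mono mult_left_mono) auto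
      finally have "16 * (\<epsilon> * M * n)\<^sup>2 \<le> 4 * (\<epsilon> * (2 * \<delta> + c * \<delta> * \<epsilon> + c * \<epsilon>) * n)"
        by (simp add: power2_eq_square algebra_simps)
      from divide_right_mono[OF this, of \<alpha>\<^sub>0] show ?thesis using \<alpha> by simp
    qed
    finally have "w / q \<le> (\<bar>\<alpha>\<^sub>\<epsilon> / \<alpha>\<^sub>0 - 1\<bar> + sqrt (\<bar>\<alpha>\<^sub>\<epsilon> / \<alpha>\<^sub>0 - 1\<bar>\<^sup>2
        + 4 * (4 * (\<epsilon> * (2 * \<delta> + c * \<delta> * \<epsilon> + c * \<epsilon>) / \<alpha>\<^sub>0) * n))) / 2"
      by (intro quadratic_root_bound) simp
    moreover have "4 * (4 * X * n) = 16 * X * n" for X by simp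
    ultimately show ?thesis by (simp only: w_def q_def n_def)
  qed
  show ?thesis
    by (rule exI[of _ C]) (unfold Let_def, blast intro: C_pos bound)
qed

end
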